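(* Let $n\ge 1$ be an integer and let $G$ be an $n$-vertex $S_{2,4}$-free planar graph. Then $e(G)\le \frac{31}{14}n$. Moreover, for every integer $n\ge 1$ with $n\equiv 0 \pmod{14}$ there exists an $n$-vertex $S_{2,4}$-free planar graph $G$ with $e(G)=\frac{31}{14}n$.
   Context: All graphs are finite and simple. $e(G)$ denotes the number of edges of $G$. The double star $S_{k,l}$ is the graph obtained from an edge $uv$ by joining $u$ to $k$ new vertices and $v$ to $l$ further new vertices (all $k+l+2$ vertices distinct); in particular $S_{2,4}$ has $8$ vertices and $7$ edges. A graph is $H$-free if it does not contain $H$ as a (not necessarily induced) subgraph. *)

theory Defs
  imports "HOL-Analysis.Analysis" "HOL-Number_Theory.Cong"
begin

type_synonym 'a ugraph = "'a set \<times> 'a set set"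

abbreviation verts :: "'a ugraph \<Rightarrow> 'a set" where "verts \<equiv> fst"
abbreviation edges :: "'a ugraph \<Rightarrow> 'a set set" where "edges \<equiv> snd"

definition finite_simple_graph :: "'a ugraph \<Rightarrow> bool" where
  "finite_simple_graph G \<longleftrightarrow>
     finite (verts G) \<and> (\<forall>e \<in> edges G. e \<subseteq> verts G \<and> card e = 2)"

definition contains_copy :: "'a ugraph \<Rightarrow> 'b ugraph \<Rightarrow> bool" where
  "contains_copy G H \<longleftrightarrow>
     (\<exists>f. inj_on f (verts H) \<and> f ` verts H \<subseteq> verts G \<and> (\<forall>e \<in> edges H. f ` e \<in> edges G))"

definition free_of :: "'a ugraph \<Rightarrow> 'b ugraph \<Rightarrow> bool" where
  "free_of G H \<longleftrightarrow> \<not> contains_copy G H"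

(* The centres u, v are 0 and 1; the leaves at u are 2, ..., k + 1, and
   the leaves at v are k + 2, ..., k + l + 1. *)
definition double_star :: "nat \<Rightarrow> nat \<Rightarrow> nat ugraph" where
  "double_star k l =
     ({..<k + l + 2},
      {{0, 1}} \<union> {{0, i} | i. i \<in> {2..<k + 2}} \<union> {{1, i} | i. i \<in> {k + 2..<k + l + 2}})"

(* The Euclidean plane is the type complex. Edges are drawn as simple arcs joining their end
   points; they contain no other vertex, and two of them meet only at common end vertices. *)
definition plane_drawing ::
    "'a ugraph \<Rightarrow> ('a \<Rightarrow> complex) \<Rightarrow> ('a set \<Rightarrow> real \<Rightarrow> complex) \<Rightarrow> bool" where
  "plane_drawing G p c \<longleftrightarrow>
     inj_on p (verts G) \<and>
     (\<forall>e \<in> edges G. arc (c e) \<and> {pathstart (c e), pathfinish (c e)} = p ` e \<and>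
        path_image (c e) \<inter> p ` verts G = p ` e) \<and>
     (\<forall>e \<in> edges G. \<forall>e' \<in> edges G. e \<noteq> e' \<longrightarrow>
        path_image (c e) \<inter> path_image (c e') = p ` (e \<inter> e'))"

definition planar :: "'a ugraph \<Rightarrow> bool" where
  "planar G \<longleftrightarrow> (\<exists>p c. plane_drawing G p c)"

end

theory Submission
  imports Defs
begin

text \<open>
  An edge \<open>uv\<close> with \<open>deg u \<ge> 5\<close> and \<open>deg v \<ge> 3\<close> is the centre of an \<open>S\<^sub>2\<^sub>,\<^sub>4\<close> unless
  \<open>|N(u) \<union> N(v)| \<le> 7\<close>. In a minimal counterexample to the bound all degrees are at least 3, so
  there is no vertex of degree above 6, and a vertex of degree 6 dominates a component with 7
  vertices, which by planarity has at most 15 edges. Hence the degrees are 3, 4 and 5. Give a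
  vertex of degree \<open>d\<close> the weight \<open>31 - 7d\<close>. As \<open>K\<^sub>3\<^sub>,\<^sub>3\<close> is excluded, adjacency is transitive
  on the vertices of degree 5, so these fall into cliques, and cliques with at least two vertices
  have disjoint neighbourhoods; excluding \<open>K\<^sub>3\<^sub>,\<^sub>3\<close> and \<open>K\<^sub>5\<close> shows that the positive weight around
  each clique compensates for it.

  For a drawing, \<open>K\<^sub>3\<^sub>,\<^sub>3\<close> and \<open>K\<^sub>5\<close> are both excluded by one fact about theta curves: a connected
  set that avoids the curve and accumulates at interior points of two of its arcs is separated
  by these two arcs from the third.

  The bound is attained by pairs of octahedra with an extra vertex on one face, the two extra
  vertices being joined by an edge.
\<close>

subsection \<open>Theta curves\<close>

text \<open>As \<open>14 * card E\<close> is seven times the degree sum, the bound says that the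
  weights have a nonnegative sum: degrees 3, 4, 5 count 10, 3 and -4. Cliques of 2, 3, 4 vertices of
  degree 5 thus need 8, 12 and 16 from their outer neighbours. Size 2 is easy; for sizes 3 and 4 the
  estimates 4 * 3 and 10 + 3 + 3 leave no slack. The delicate case is a clique of size 4 with three
  outer neighbours: if these all had degree 4 they would supply only 9. Vertices of degree 5 without
  a neighbour of degree 5 may share neighbours and are treated by double counting instead. The
  number 15 = 3 * 7 - 6 is reached without Euler's formula: too many edges below a dominating vertex
  force K5 or K33, if need be after one vertex is deleted or suppressed. The extremal graphs realise
  the tight clique of size 3: in a block the vertices 1, 2, 3 form it, and its outer neighbours 0,
  4, 5, 6 all have degree 4 once a bridge is attached to 0. Two blocks and a bridge have 2 * 15 + 1
  = 31 edges on 14 vertices.\<close>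

lemma arc_endless:
  assumes "arc g"
  shows "path_image g - {pathstart g, pathfinish g} = g ` {0<..<1}"
    and "path_image g - {pathfinish g} = g ` {0..<1}"
proof -
  have inj: "inj_on g {0..1}"
    using assms by (simp add: arc_def)
  have "{0..1} = {0<..<1} \<union> {0, 1::real}" "{0..1} = {0..<1} \<union> {1::real}"
    by auto
  then have "g ` {0..1} = g ` {0<..<1} \<union> {g 0, g 1}" "g ` {0..1} = g ` {0..<1} \<union> {g 1}"
    by (metis image_Un image_insert image_empty)+
  then have im: "path_image g = g ` {0<..<1} \<union> {g 0, g 1}" "path_image g = g ` {0..<1} \<union> {g 1}"
    by (simp_all only: path_image_def)
  have "g 0 \<notin> g ` {0<..<1}" "g 1 \<notin> g ` {0<..<1}" "g 1 \<notin> g ` {0..<1}"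
    using inj_on_image_mem_iff[OF inj] by (auto simp: subset_iff)
  note ends = this
  show "path_image g - {pathstart g, pathfinish g} = g ` {0<..<1}"
    unfolding pathstart_def pathfinish_def im(1) using ends(1,2) by simp
  show "path_image g - {pathfinish g} = g ` {0..<1}"
    unfolding pathfinish_def im(2) using ends(3) by simp
qed

lemma endpoint_in_closure_arc:
  assumes "arc g"
  shows "pathfinish g \<in> closure (path_image g - {pathstart g, pathfinish g})"
    and "pathstart g \<in> closure (path_image g - {pathstart g, pathfinish g})"
proof -
  have "continuous_on (closure {0<..<1}) g"
    using arc_imp_path[OF assms] by (simp add: path_def)
  then have "g ` closure {0<..<1} \<subseteq> closure (g ` {0<..<1})"
    by (rule image_closure_subset) (auto simp: closure_subset)
  then show "pathfinish g \<in> closure (path_image g - {pathstart g, pathfinish g})"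
    and "pathstart g \<in> closure (path_image g - {pathstart g, pathfinish g})"
    unfolding arc_endless[OF assms] by (auto simp: pathfinish_def pathstart_def)
qed

lemma connected_arc_minus_endpoint:
  assumes "arc g"
  shows "connected (path_image g - {pathfinish g})"
proof -
  have "continuous_on {0..<1} g"
    using arc_imp_path[OF assms] unfolding path_def by (rule continuous_on_subset) auto
  then show ?thesis
    unfolding arc_endless(2)[OF assms] by (simp add: connected_continuous_image)
qed

lemma arc_interior_nonempty:
  assumes "arc g"
  shows "path_image g - {pathstart g, pathfinish g} \<noteq> {}"
  using assms by (simp add: arc_endless)

text \<open>Inside and outside are kept interchangeable, so that \<open>chord_separates\<close> can
  give the name \<open>S\<close> to whichever side contains its point.\<close>

lemma Jordan_sides:
  fixes c1 c2 :: "real \<Rightarrow> complex"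
  assumes "arc c1" "arc c2" "pathstart c1 = a" "pathfinish c1 = b" "pathstart c2 = a" "pathfinish c2 = b"
    and "path_image c1 \<inter> path_image c2 = {a, b}"
  obtains S T where "open S" "connected S" "open T" "connected T" "S \<inter> T = {}"
    "S \<union> T = - (path_image c1 \<union> path_image c2)"
    "frontier S = path_image c1 \<union> path_image c2"
    "frontier T = path_image c1 \<union> path_image c2" "S \<noteq> {}" "T \<noteq> {}"
proof -
  let ?g = "c1 +++ reversepath c2"
  have "simple_path ?g"
    using assms by (intro simple_path_join_loop) (auto simp: arc_reversepath)
  moreover have "pathfinish ?g = pathstart ?g"
    using assms by simp
  moreover have "path_image ?g = path_image c1 \<union> path_image c2"
    using assms by (simp add: path_image_join)
  ultimately show ?thesis
    using Jordan_inside_outside[of ?g] that by metis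
qed

text \<open>If the conclusion failed, then a point of \<open>D\<close> and a point beyond the Jordan curve
  \<open>c1 \<union> c2\<close> would be separated neither by \<open>c1 \<union> c3\<close> nor by
  \<open>c2 \<union> c3\<close>, hence by Janiszewski's theorem not by the union of the three arcs.\<close>

lemma chord_separates:
  fixes c1 c2 c3 :: "real \<Rightarrow> complex"
  assumes arcs: "arc c1" "arc c2" "arc c3"
    and ends: "pathstart c1 = a" "pathfinish c1 = b" "pathstart c2 = a" "pathfinish c2 = b"
      "pathstart c3 = a" "pathfinish c3 = b"
    and int: "path_image c1 \<inter> path_image c2 = {a, b}" "path_image c1 \<inter> path_image c3 = {a, b}"
      "path_image c2 \<inter> path_image c3 = {a, b}"
    and D: "connected D" "D \<inter> (path_image c1 \<union> path_image c2 \<union> path_image c3) = {}"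
    and x: "x \<in> closure D" "x \<in> path_image c1 - {a, b}"
    and y: "y \<in> closure D" "y \<in> path_image c2 - {a, b}"
    and p: "p \<in> D" and q: "q \<in> path_image c3 - {a, b}"
  shows "\<not> connected_component (- (path_image c1 \<union> path_image c2)) p q"
proof
  let ?J = "path_image c1 \<union> path_image c2"
  assume "connected_component (- ?J) p q"
  then obtain K where K: "connected K" "K \<inter> ?J = {}" "p \<in> K" "q \<in> K"
    unfolding connected_component_def by blast
  obtain S T where ST: "open S" "connected S" "open T" "connected T" "S \<inter> T = {}" "S \<union> T = - ?J"
    "frontier S = ?J" "frontier T = ?J" "S \<noteq> {}" "T \<noteq> {}" and pS: "p \<in> S"
  proof -
    obtain S T where ST: "open S" "connected S" "open T" "connected T" "S \<inter> T = {}" "S \<union> T = - ?J"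
      "frontier S = ?J" "frontier T = ?J" "S \<noteq> {}" "T \<noteq> {}"
      using Jordan_sides[OF arcs(1,2) ends(1-4) int(1)] by blast
    have "p \<in> S \<or> p \<in> T"
      using p D ST by blast
    then show ?thesis
      using that[OF ST] that[OF ST(3,4,1,2) _ _ ST(8,7,10,9)] ST(5,6) by blast
  qed
  have side: "C \<subseteq> S" if "connected C" "C \<inter> ?J = {}" "C \<inter> S \<noteq> {}" for C
    using connectedD[OF that(1) ST(1,3)] that ST(5,6) by blast
  have "K \<subseteq> S"
    using K pS by (intro side) auto
  have DS: "D \<subseteq> S"
    using D p pS by (intro side) auto
  have con3: "connected (path_image c3 - {a, b})"
    using connected_simple_path_endless[OF arc_imp_simple_path[OF arcs(3)]] ends by simp
  have c3S: "path_image c3 - {a, b} \<subseteq> S"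
  proof (rule side[OF con3])
    show "(path_image c3 - {a, b}) \<inter> ?J = {}"
      using int(2,3) by blast
    show "(path_image c3 - {a, b}) \<inter> S \<noteq> {}"
      using q K(4) \<open>K \<subseteq> S\<close> by blast
  qed
  obtain r where r: "r \<in> T"
    using ST(10) by blast
  \<comment> \<open>The arc \<open>d'\<close> without its ends lies on the frontier of
    \<open>T\<close>, and \<open>D\<close> accumulates at its point \<open>z\<close>. So
    \<open>D\<close>, \<open>z\<close>, this open arc and \<open>T\<close> together are connected;
    they miss \<open>d\<close> and \<open>c3\<close> and hence lead from \<open>p\<close> to the far
    side.\<close>
  have beyond: "connected_component (- (path_image d \<union> path_image c3)) p r"
    if d: "path_image d \<subseteq> ?J" "path_image d \<inter> path_image d' = {a, b}"
      "path_image d' \<inter> path_image c3 = {a, b}" "path_image d' \<subseteq> ?J"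
      and d': "arc d'" "pathstart d' = a" "pathfinish d' = b"
      and z: "z \<in> closure D" "z \<in> path_image d' - {a, b}" for d d' z
  proof -
    let ?A = "D \<union> {z}" and ?B = "T \<union> (path_image d' - {a, b})"
    have "connected ?A"
      by (rule connected_intermediate_closure[OF D(1)]) (use z closure_subset in auto)
    moreover have "connected ?B"
    proof (rule connected_intermediate_closure[OF ST(4)])
      show "?B \<subseteq> closure T"
        using ST(8) d(4) closure_Un_frontier[of T] by blast
    qed auto
    ultimately have "connected (?A \<union> ?B)"
      by (rule connected_Un) (use z in blast)
    moreover have "?A \<union> ?B \<subseteq> - (path_image d \<union> path_image c3)"
    proof -
      have "T \<inter> path_image c3 = {}"
        using c3S ST(5,6) ends(5,6) int(2) by blast
      moreover have "T \<inter> path_image d = {}" "(path_image d' - {a, b}) \<inter> path_image d = {}"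
          "(path_image d' - {a, b}) \<inter> path_image c3 = {}"
          "D \<inter> (path_image d \<union> path_image c3) = {}"
        using d D(2) ST(6) by blast+
      moreover have "z \<notin> path_image d \<union> path_image c3"
        using z(2) d by blast
      ultimately show ?thesis
        by auto
    qed
    ultimately show ?thesis
      unfolding connected_component_def using p r by blast
  qed
  have "connected_component (- (path_image c1 \<union> path_image c3)) p r"
    using int arcs(2) ends y by (intro beyond[of c1 c2 y]) simp_all
  moreover have "connected_component (- (path_image c2 \<union> path_image c3)) p r"
    using int arcs(1) ends x by (intro beyond[of c2 c1 x]) (simp_all add: Int_commute)
  \<comment> \<open>Janiszewski's theorem asks for a connected intersection of the two closed
    curves; it is the third arc.\<close>
  moreover have "(path_image c1 \<union> path_image c3) \<inter> (path_image c2 \<union> path_image c3) = path_image c3"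
    using int by blast
  ultimately have "connected_component (- ((path_image c1 \<union> path_image c3) \<union> (path_image c2 \<union> path_image c3))) p r"
    using Janiszewski[of "path_image c1 \<union> path_image c3" "path_image c2 \<union> path_image c3" p r]
    by (simp only: arcs compact_Un closed_Un compact_arc_image closed_arc_image connected_arc_image)
  then obtain L where "connected L" "L \<inter> ?J = {}" "p \<in> L" "r \<in> L"
    unfolding connected_component_def by blast
  then show False
    using side[of L] pS r ST(5) by blast
qed

text \<open>Pigeonhole on the two sides. \<open>no_K5\<close> contradicts it with three points that
  are pairwise separated by a 4-cycle.\<close>

lemma Jordan_two_sides:
  fixes c1 c2 :: "real \<Rightarrow> complex"
  assumes "arc c1" "arc c2" "pathstart c1 = a" "pathfinish c1 = b" "pathstart c2 = a" "pathfinish c2 = b"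
    and "path_image c1 \<inter> path_image c2 = {a, b}"
    and "p \<notin> path_image c1 \<union> path_image c2" "q \<notin> path_image c1 \<union> path_image c2"
      "r \<notin> path_image c1 \<union> path_image c2"
  defines "J \<equiv> path_image c1 \<union> path_image c2"
  shows "connected_component (- J) p q \<or> connected_component (- J) q r \<or> connected_component (- J) p r"
proof -
  obtain S T where ST: "connected S" "connected T" "S \<union> T = - J"
    using Jordan_sides[OF assms(1-7)] unfolding J_def by metis
  have sub: "S \<subseteq> - J" "T \<subseteq> - J"
    using ST by auto
  have "(p \<in> S \<and> q \<in> S \<or> p \<in> T \<and> q \<in> T) \<or> (q \<in> S \<and> r \<in> S \<or> q \<in> T \<and> r \<in> T) \<or> (p \<in> S \<and> r \<in> S \<or> p \<in> T \<and> r \<in> T)"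
    using assms ST by blast
  then show ?thesis
    unfolding connected_component_def using ST(1,2) sub by metis
qed

section \<open>The graphs K33 and K5 in a plane drawing\<close>

locale drawn_graph =
  fixes V :: "'a set" and E :: "'a set set" and p :: "'a \<Rightarrow> complex" and c :: "'a set \<Rightarrow> real \<Rightarrow> complex"
  assumes drawing: "plane_drawing (V, E) p c"
    and edge_sub: "\<And>e. e \<in> E \<Longrightarrow> e \<subseteq> V \<and> card e = 2"
begin

abbreviation "im x y \<equiv> path_image (c {x, y})"

lemma pos_eq: "x \<in> V \<Longrightarrow> y \<in> V \<Longrightarrow> p x = p y \<longleftrightarrow> x = y"
  using drawing by (auto simp: plane_drawing_def inj_on_def)

lemma edgeD: "{x, y} \<in> E \<Longrightarrow> x \<in> V \<and> y \<in> V \<and> x \<noteq> y"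
  using edge_sub[of "{x, y}"] by (auto simp: card_insert_if)

lemma im_Int: "e \<in> E \<Longrightarrow> e' \<in> E \<Longrightarrow> e \<noteq> e' \<Longrightarrow> path_image (c e) \<inter> path_image (c e') = p ` (e \<inter> e')"
  using drawing by (auto simp: plane_drawing_def)

lemma im_pos: "{x, y} \<in> E \<Longrightarrow> z \<in> V \<Longrightarrow> p z \<in> im x y \<longleftrightarrow> z = x \<or> z = y"
proof -
  assume "{x, y} \<in> E" "z \<in> V"
  then have "im x y \<inter> p ` V = p ` {x, y}"
    using drawing by (simp add: plane_drawing_def)
  then have "p z \<in> im x y \<longleftrightarrow> p z \<in> p ` {x, y}"
    using \<open>z \<in> V\<close> by blast
  then show ?thesis
    using edgeD[OF \<open>{x, y} \<in> E\<close>] \<open>z \<in> V\<close> pos_eq by auto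
qed

text \<open>A drawing does not fix the direction in which the curve of an edge runs; it is reversed
  where necessary.\<close>

lemma edge_arc:
  assumes "{x, y} \<in> E"
  obtains g where "arc g" "pathstart g = p x" "pathfinish g = p y" "path_image g = im x y"
proof -
  have *: "arc (c {x, y})" "{pathstart (c {x, y}), pathfinish (c {x, y})} = {p x, p y}"
    using drawing assms by (auto simp: plane_drawing_def)
  show ?thesis
  proof (cases "pathstart (c {x, y}) = p x")
    case True
    then show ?thesis
      using * that[of "c {x, y}"] by (auto simp: doubleton_eq_iff)
  next
    case False
    then show ?thesis
      using * that[of "reversepath (c {x, y})"] by (auto simp: doubleton_eq_iff arc_reversepath)
  qed
qed

lemma path2:
  assumes "{x, y} \<in> E" "{y, z} \<in> E" "x \<noteq> z"
  obtains g where "arc g" "pathstart g = p x" "pathfinish g = p z" "path_image g = im x y \<union> im y z"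
proof -
  obtain g1 where g1: "arc g1" "pathstart g1 = p x" "pathfinish g1 = p y" "path_image g1 = im x y"
    using edge_arc[OF assms(1)] .
  obtain g2 where g2: "arc g2" "pathstart g2 = p y" "pathfinish g2 = p z" "path_image g2 = im y z"
    using edge_arc[OF assms(2)] .
  have "im x y \<inter> im y z = p ` ({x, y} \<inter> {y, z})"
    using assms edgeD by (intro im_Int) (auto simp: doubleton_eq_iff)
  also have "\<dots> = {p y}"
    using assms edgeD by auto
  finally have "arc (g1 +++ g2)"
    using g1 g2 by (intro arc_join) auto
  then show ?thesis
    using that[of "g1 +++ g2"] g1 g2 by (simp add: path_image_join)
qed

text \<open>The far ends are removed and survive only in the closure. This makes the star fit the
  role of \<open>D\<close> in \<open>chord_separates\<close>: connected, disjoint from the curve,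
  accumulating at vertices on it.\<close>

definition star :: "'a \<Rightarrow> 'a set \<Rightarrow> complex set" where
  "star d S = insert (p d) (\<Union>s\<in>S. im d s - {p s})"

lemma connected_star:
  assumes "\<And>s. s \<in> S \<Longrightarrow> {d, s} \<in> E"
  shows "connected (star d S)"
proof (cases "S = {}")
  case False
  have "connected (im d s - {p s}) \<and> p d \<in> im d s - {p s}" if "s \<in> S" for s
  proof -
    have e: "{d, s} \<in> E"
      using that assms by blast
    then obtain g where g: "arc g" "pathstart g = p d" "pathfinish g = p s" "path_image g = im d s"
      by (rule edge_arc)
    then show ?thesis
      using connected_arc_minus_endpoint[OF g(1)] im_pos[OF e, of d] edgeD[OF e] pos_eq[of d s] by auto
  qed
  then have "connected (\<Union>s\<in>S. im d s - {p s})" "p d \<in> (\<Union>s\<in>S. im d s - {p s})"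
    using False by (auto intro!: connected_Union)
  then show ?thesis
    by (simp add: star_def insert_absorb)
qed (simp add: star_def)

lemma edge_interior:
  assumes e: "{x, y} \<in> E"
  shows "connected (im x y - {p x, p y})"
    and "p x \<in> closure (im x y - {p x, p y})" "p y \<in> closure (im x y - {p x, p y})"
    and "im x y - {p x, p y} \<noteq> {}"
proof -
  obtain g where g: "arc g" "pathstart g = p x" "pathfinish g = p y" "path_image g = im x y"
    using e by (rule edge_arc)
  show "connected (im x y - {p x, p y})"
    using connected_simple_path_endless[OF arc_imp_simple_path[OF g(1)]] g by simp
  show "p x \<in> closure (im x y - {p x, p y})" "p y \<in> closure (im x y - {p x, p y})"
    using endpoint_in_closure_arc[OF g(1)] g by simp_all
  show "im x y - {p x, p y} \<noteq> {}"
    using arc_interior_nonempty[OF g(1)] g by simp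
qed

lemma closure_star:
  assumes "s \<in> S" "{d, s} \<in> E"
  shows "p s \<in> closure (star d S)"
proof -
  have "im d s - {p d, p s} \<subseteq> star d S"
    using assms by (auto simp: star_def)
  then show ?thesis
    using edge_interior(3)[OF assms(2)] closure_mono[of "im d s - {p d, p s}" "star d S"] by blast
qed

lemma im_disjoint:
  assumes "{x, y} \<in> E" "{z, w} \<in> E" "z \<noteq> x" "z \<noteq> y" "w \<noteq> x" "w \<noteq> y"
  shows "im x y \<inter> im z w = {}"
proof -
  have "im x y \<inter> im z w = p ` ({x, y} \<inter> {z, w})"
    using assms by (intro im_Int) (auto simp: doubleton_eq_iff)
  moreover have "{x, y} \<inter> {z, w} = {}"
    using assms by auto
  ultimately show ?thesis
    by simp
qed

lemma im_meet:
  assumes "{x, y} \<in> E" "{x, z} \<in> E" "y \<noteq> z"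
  shows "im x y \<inter> im x z = {p x}"
proof -
  have "im x y \<inter> im x z = p ` ({x, y} \<inter> {x, z})"
    using assms by (intro im_Int) (auto simp: doubleton_eq_iff)
  also have "{x, y} \<inter> {x, z} = {x}"
    using assms edgeD by auto
  finally show ?thesis
    by simp
qed

definition path2_im :: "'a \<Rightarrow> 'a \<Rightarrow> 'a \<Rightarrow> complex set" where
  "path2_im x y z = im x y \<union> im y z"

lemma path2_im_Int:
  assumes "{a, v} \<in> E" "{v, b} \<in> E" "{a, w} \<in> E" "{w, b} \<in> E" "a \<noteq> b" "v \<noteq> w"
  shows "path2_im a v b \<inter> path2_im a w b = {p a, p b}"
proof -
  have n: "a \<noteq> v" "b \<noteq> v" "a \<noteq> w" "b \<noteq> w"
    using edgeD assms by blast+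
  have "im a v \<inter> im a w = {p a}" "im v b \<inter> im w b = {p b}"
    using im_meet[of a v w] im_meet[of b v w] assms by (simp_all add: insert_commute)
  moreover have "im a v \<inter> im w b = {}" "im v b \<inter> im a w = {}"
    using n assms im_disjoint[of a v w b] im_disjoint[of v b a w] by simp_all
  moreover have "path2_im a v b \<inter> path2_im a w b =
      (im a v \<inter> im a w \<union> im a v \<inter> im w b) \<union> (im v b \<inter> im a w \<union> im v b \<inter> im w b)"
    unfolding path2_im_def by blast
  ultimately show ?thesis
    by (simp add: insert_commute)
qed

lemma path2_im_Int_edge:
  assumes "{a, v} \<in> E" "{v, b} \<in> E" "{a, b} \<in> E"
  shows "path2_im a v b \<inter> im a b = {p a, p b}"
proof -
  have n: "a \<noteq> v" "b \<noteq> v" "a \<noteq> b"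
    using edgeD assms by blast+
  have "im a v \<inter> im a b = {p a}" "im v b \<inter> im a b = {p b}"
    using im_meet[of a v b] im_meet[of b v a] assms n by (simp_all add: insert_commute)
  then show ?thesis
    by (auto simp: path2_im_def Int_Un_distrib2)
qed

text \<open>This is \<open>chord_separates\<close> with branch points \<open>a\<close>,
  \<open>b\<close> and two arcs that are paths of length 2, the accumulation points being their
  middle vertices. The third arc \<open>g\<close> stays general because it is a path of length 2 for
  K33 and a single edge for K5.\<close>

lemma quad_separates:
  assumes e: "{a, v} \<in> E" "{v, b} \<in> E" "{a, w} \<in> E" "{w, b} \<in> E" and ne: "a \<noteq> b" "v \<noteq> w"
    and g: "arc g" "pathstart g = p a" "pathfinish g = p b"
      "path2_im a v b \<inter> path_image g = {p a, p b}" "path2_im a w b \<inter> path_image g = {p a, p b}"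
    and D: "connected D" "D \<inter> (path2_im a v b \<union> path2_im a w b \<union> path_image g) = {}"
      "p v \<in> closure D" "p w \<in> closure D" "d \<in> D"
    and q: "q \<in> path_image g - {p a, p b}"
  shows "\<not> connected_component (- (path2_im a v b \<union> path2_im a w b)) d q"
proof -
  have V: "a \<in> V" "b \<in> V" "v \<in> V" "w \<in> V" "v \<noteq> a" "v \<noteq> b" "w \<noteq> a" "w \<noteq> b"
    using edgeD e by blast+
  obtain g1 where g1: "arc g1" "pathstart g1 = p a" "pathfinish g1 = p b" "path_image g1 = path2_im a v b"
    using path2[OF e(1,2) ne(1)] unfolding path2_im_def by blast
  obtain g2 where g2: "arc g2" "pathstart g2 = p a" "pathfinish g2 = p b" "path_image g2 = path2_im a w b"
    using path2[OF e(3,4) ne(1)] unfolding path2_im_def by blast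
  have vw: "p v \<in> path2_im a v b" "p w \<in> path2_im a w b"
    unfolding path2_im_def using im_pos e V by auto
  have "\<not> connected_component (- (path_image g1 \<union> path_image g2)) d q"
  proof (rule chord_separates[OF g1(1) g2(1) g(1) g1(2,3) g2(2,3) g(2,3) _ _ _ D(1) _ D(3) _ D(4) _ D(5) q])
    show "path_image g1 \<inter> path_image g2 = {p a, p b}"
      unfolding g1 g2 using e ne by (rule path2_im_Int)
    show "p v \<in> path_image g1 - {p a, p b}" "p w \<in> path_image g2 - {p a, p b}"
      unfolding g1 g2 using vw V pos_eq by auto
  qed (use g D(2) g1(4) g2(4) in simp_all)
  then show ?thesis
    by (simp add: g1 g2)
qed

text \<open>Distinct edges meet only in common ends; here such an end is a far end of the star,
  which \<open>star\<close> omits.\<close>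

lemma star_disjoint:
  assumes S: "\<And>s. s \<in> S \<Longrightarrow> {d, s} \<in> E" and "S \<noteq> {}"
    and e: "{x, y} \<in> E" "d \<noteq> x" "d \<noteq> y"
  shows "star d S \<inter> im x y = {}"
proof -
  have "p d \<notin> im x y"
    using im_pos[OF e(1), of d] edgeD S \<open>S \<noteq> {}\<close> e by blast
  moreover have "(im d s - {p s}) \<inter> im x y = {}" if "s \<in> S" for s
  proof -
    have "im d s \<inter> im x y = p ` ({d, s} \<inter> {x, y})"
      using e S[OF that] by (intro im_Int) (auto simp: doubleton_eq_iff)
    moreover have "{d, s} \<inter> {x, y} \<subseteq> {s}"
      using e by auto
    ultimately show ?thesis
      by blast
  qed
  ultimately show ?thesis
    unfolding star_def by blast
qed

lemma in_star: "d \<in> V \<Longrightarrow> p d \<in> star d S"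
  by (simp add: star_def)

text \<open>In the theta curve formed by the paths from \<open>a\<close> to \<open>b\<close> through
  \<open>x\<close>, \<open>y\<close>, \<open>z\<close>, the star of \<open>d\<close> accumulates at
  \<open>x\<close> and \<open>y\<close>. So the 4-cycle \<open>a x b y\<close> separates
  \<open>d\<close> from \<open>z\<close>, although the edge \<open>d z\<close> avoids it.\<close>

lemma no_K33:
  assumes A: "card A = 3" and B: "card B = 3" and "A \<inter> B = {}"
    and E: "\<And>a b. a \<in> A \<Longrightarrow> b \<in> B \<Longrightarrow> {a, b} \<in> E"
  shows False
proof -
  obtain a b d where A': "A = {a, b, d}" "a \<noteq> b" "a \<noteq> d" "b \<noteq> d"
    using A unfolding card_3_iff by blast
  obtain x y z where B': "B = {x, y, z}" "x \<noteq> y" "x \<noteq> z" "y \<noteq> z"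
    using B unfolding card_3_iff by blast
  have e: "{a, v} \<in> E" "{v, b} \<in> E" "{d, v} \<in> E" if "v \<in> {x, y, z}" for v
    using E[of a v] E[of b v] E[of d v] that unfolding A'(1) B'(1) by (simp_all add: insert_commute)
  have V: "d \<in> V" "z \<in> V" "z \<noteq> a" "z \<noteq> b" "a \<in> V" "b \<in> V"
    using edgeD[OF e(3)[of z]] edgeD[OF e(1)[of z]] edgeD[OF e(2)[of z]] by auto
  let ?D = "star d {x, y, z}"
  have D0: "?D \<inter> path2_im a v b = {}" if "v \<in> {x, y, z}" for v
  proof -
    have "d \<noteq> v"
      using edgeD[OF e(3)[OF that]] by blast
    have "?D \<inter> im a v = {}"
      by (rule star_disjoint) (use e that A' \<open>d \<noteq> v\<close> in auto)
    moreover have "?D \<inter> im v b = {}"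
      by (rule star_disjoint) (use e that A' \<open>d \<noteq> v\<close> in auto)
    ultimately show ?thesis
      by (simp add: path2_im_def Int_Un_distrib)
  qed
  obtain g where g: "arc g" "pathstart g = p a" "pathfinish g = p b" "path_image g = path2_im a z b"
    using path2[of a z b] e[of z] A' unfolding path2_im_def by blast
  have "\<not> connected_component (- (path2_im a x b \<union> path2_im a y b)) (p d) (p z)"
  proof (rule quad_separates[OF _ _ _ _ A'(2) B'(2) g(1-3)])
    show "connected ?D"
      using e by (intro connected_star) blast
    show "?D \<inter> (path2_im a x b \<union> path2_im a y b \<union> path_image g) = {}"
      unfolding g Int_Un_distrib using D0 by simp
    show "p x \<in> closure ?D" "p y \<in> closure ?D"
      using e by (simp_all add: closure_star)
    show "p z \<in> path_image g - {p a, p b}"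
      unfolding g path2_im_def using im_pos[of a z z] e[of z] V pos_eq by simp
    show "path2_im a x b \<inter> path_image g = {p a, p b}" "path2_im a y b \<inter> path_image g = {p a, p b}"
      unfolding g using e A'(2) B'(2-4) by (simp_all add: path2_im_Int)
  qed (use e V in_star in auto)
  moreover have "connected_component (- (path2_im a x b \<union> path2_im a y b)) (p d) (p z)"
    unfolding connected_component_def
  proof (intro exI conjI)
    show "connected (im d z)"
      using edge_arc[OF e(3)[of z]] connected_arc_image by (metis insertCI)
    have "im d z \<inter> im a v = {}" "im d z \<inter> im v b = {}" if "v \<in> {x, y}" for v
      using e[of z] e[of v] that A' B' V edgeD[OF e(3)[of v]]
      by - (rule im_disjoint; auto)+
    then show "im d z \<subseteq> - (path2_im a x b \<union> path2_im a y b)"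
      unfolding path2_im_def by blast
    show "p d \<in> im d z" "p z \<in> im d z"
      using im_pos[of d z] e[of z] V by auto
  qed
  ultimately show False
    by simp
qed

text \<open>The 4-cycle \<open>a v b w\<close> would separate pairwise the vertex \<open>d\<close>,
  a point \<open>q\<close> inside the edge \<open>a b\<close> and a point \<open>r\<close> inside
  the edge \<open>v w\<close>, but it has only two sides. The connected set is the star of
  \<open>d\<close> for the pairs with \<open>d\<close>, and the open edge \<open>v w\<close> for
  \<open>r\<close> and \<open>q\<close>.\<close>

lemma no_K5:
  assumes K: "card K = 5" and E: "\<And>x y. x \<in> K \<Longrightarrow> y \<in> K \<Longrightarrow> x \<noteq> y \<Longrightarrow> {x, y} \<in> E"
  shows False
proof -
  obtain vs where vs: "set vs = K" "distinct vs" "length vs = 5"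
    using K by (metis card.infinite distinct_card finite_distinct_list zero_neq_numeral)
  then obtain a b v w d where "vs = [a, b, v, w, d]"
    by (auto simp: numeral_eq_Suc length_Suc_conv)
  with vs have K': "K = {a, b, v, w, d}" and ne: "distinct [a, b, v, w, d]"
    by auto
  have e: "{x, y} \<in> E" if "x \<in> {a, b, v, w, d}" "y \<in> {a, b, v, w, d}" "x \<noteq> y" for x y
    using E that K' by blast
  have V: "a \<in> V" "b \<in> V" "v \<in> V" "w \<in> V" "d \<in> V"
    using edgeD[OF e[of a b]] edgeD[OF e[of v w]] edgeD[OF e[of d w]] ne by auto
  let ?Q = "path2_im a v b \<union> path2_im a w b"
  \<comment> \<open>The same 4-cycle, read with \<open>v\<close>, \<open>w\<close> instead of
    \<open>a\<close>, \<open>b\<close> as branch points.\<close>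
  have Q': "path2_im v a w \<union> path2_im v b w = ?Q"
    unfolding path2_im_def by (auto simp: insert_commute)
  have sep: "\<not> connected_component (- (path2_im a v b \<union> path2_im a w b)) s q"
    if abvw: "{a, v} \<in> E" "{v, b} \<in> E" "{a, w} \<in> E" "{w, b} \<in> E" "{a, b} \<in> E" "a \<noteq> b" "v \<noteq> w"
      and D: "connected D" "D \<inter> (path2_im a v b \<union> path2_im a w b \<union> im a b) = {}"
      "p v \<in> closure D" "p w \<in> closure D" "s \<in> D" "q \<in> im a b - {p a, p b}"
    for a b v w s q and D
  proof -
    obtain g where g: "arc g" "pathstart g = p a" "pathfinish g = p b" "path_image g = im a b"
      using edge_arc[OF abvw(5)] .
    show ?thesis
      by (rule quad_separates[OF abvw(1-4,6,7) g(1-3) _ _ D(1) _ D(3,4,5)])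
         (use path2_im_Int_edge abvw D g in simp_all)
  qed
  have star: "\<not> connected_component (- (path2_im a v b \<union> path2_im a w b)) (p d) q"
    if abvw: "{a, v} \<in> E" "{v, b} \<in> E" "{a, w} \<in> E" "{w, b} \<in> E" "{a, b} \<in> E" "a \<noteq> b" "v \<noteq> w"
      and d: "{d, v} \<in> E" "{d, w} \<in> E" "d \<noteq> a" "d \<noteq> b" and "q \<in> im a b - {p a, p b}"
    for a b v w q
  proof (rule sep[OF abvw _ _ _ _ in_star[OF V(5), of "{v, w}"] that(12)])
    have dv: "d \<noteq> v" "d \<noteq> w"
      using edgeD d by blast+
    show "connected (star d {v, w})"
      using d by (intro connected_star) auto
    have "star d {v, w} \<inter> im x y = {}" if "{x, y} \<in> E" "d \<noteq> x" "d \<noteq> y" for x y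
      using d that by (intro star_disjoint) auto
    then show "star d {v, w} \<inter> (path2_im a v b \<union> path2_im a w b \<union> im a b) = {}"
      using abvw d dv unfolding path2_im_def Int_Un_distrib by simp
    show "p v \<in> closure (star d {v, w})" "p w \<in> closure (star d {v, w})"
      using d by (simp_all add: closure_star)
  qed
  obtain q where q: "q \<in> im a b - {p a, p b}"
    using edge_interior(4)[OF e[of a b]] ne by auto
  obtain r where r: "r \<in> im v w - {p v, p w}"
    using edge_interior(4)[OF e[of v w]] ne by auto
  have "\<not> connected_component (- ?Q) (p d) q"
    by (rule star) (use e ne q in auto)
  moreover have "\<not> connected_component (- (path2_im v a w \<union> path2_im v b w)) (p d) r"
    by (rule star) (use e ne r in auto)
  then have "\<not> connected_component (- ?Q) (p d) r"
    unfolding Q' .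
  moreover have vw: "im v w \<inter> im a b = {}" "im v w \<inter> im a v = {p v}" "im v w \<inter> im v b = {p v}"
      "im v w \<inter> im a w = {p w}" "im v w \<inter> im w b = {p w}"
    using im_disjoint[of v w a b] im_meet[of v w a] im_meet[of v w b] im_meet[of w v a] im_meet[of w v b]
      e ne by (auto simp: insert_commute)
  have "\<not> connected_component (- ?Q) r q"
  proof (rule sep)
    show "connected (im v w - {p v, p w})" "p v \<in> closure (im v w - {p v, p w})"
        "p w \<in> closure (im v w - {p v, p w})"
      using edge_interior[OF e[of v w]] ne by simp_all
    show "(im v w - {p v, p w}) \<inter> (path2_im a v b \<union> path2_im a w b \<union> im a b) = {}"
      using vw unfolding path2_im_def by blast
  qed (use e ne r q in auto)
  moreover have "p d \<notin> ?Q"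
    unfolding path2_im_def using im_pos e V ne by auto
  moreover have "q \<notin> ?Q"
    using q path2_im_Int_edge[of a v b] path2_im_Int_edge[of a w b] e ne by auto
  moreover have "r \<notin> ?Q"
    using r vw unfolding path2_im_def by blast
  moreover have "connected_component (- ?Q) (p d) q \<or> connected_component (- ?Q) q r
      \<or> connected_component (- ?Q) (p d) r"
  proof -
    obtain g1 where g1: "arc g1" "pathstart g1 = p a" "pathfinish g1 = p b" "path_image g1 = path2_im a v b"
      using path2[of a v b] e ne unfolding path2_im_def by auto
    obtain g2 where g2: "arc g2" "pathstart g2 = p a" "pathfinish g2 = p b" "path_image g2 = path2_im a w b"
      using path2[of a w b] e ne unfolding path2_im_def by auto
    have "path_image g1 \<inter> path_image g2 = {p a, p b}"
      unfolding g1 g2 using e ne by (intro path2_im_Int) auto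
    from Jordan_two_sides[OF g1(1) g2(1) g1(2,3) g2(2,3) this] show ?thesis
      unfolding g1 g2 using calculation by blast
  qed
  ultimately show False
    using connected_component_sym by metis
qed

end

subsection \<open>Operations on planar graphs\<close>

lemma drawn_graphI:
  assumes "finite_simple_graph (V, E)" "plane_drawing (V, E) p c"
  shows "drawn_graph V E p c"
  using assms by (auto simp: drawn_graph_def finite_simple_graph_def)

lemma planar_no_K33:
  assumes "finite_simple_graph (V, E)" "planar (V, E)"
    and "card A = 3" "card B = 3" "A \<inter> B = {}" "\<And>a b. a \<in> A \<Longrightarrow> b \<in> B \<Longrightarrow> {a, b} \<in> E"
  shows False
proof -
  obtain p c where "plane_drawing (V, E) p c"
    using assms(2) by (auto simp: planar_def)
  then interpret drawn_graph V E p c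
    using assms(1) by (intro drawn_graphI)
  show False
    using no_K33 assms(3-) by metis
qed

lemma planar_no_K5:
  assumes "finite_simple_graph (V, E)" "planar (V, E)"
    and "card K = 5" "\<And>x y. x \<in> K \<Longrightarrow> y \<in> K \<Longrightarrow> x \<noteq> y \<Longrightarrow> {x, y} \<in> E"
  shows False
proof -
  obtain p c where "plane_drawing (V, E) p c"
    using assms(2) by (auto simp: planar_def)
  then interpret drawn_graph V E p c
    using assms(1) by (intro drawn_graphI)
  show False
    using no_K5 assms(3-) by metis
qed

lemma planar_subgraph:
  assumes "planar (V, E)" "V' \<subseteq> V" "E' \<subseteq> E" "\<And>e. e \<in> E' \<Longrightarrow> e \<subseteq> V'"
  shows "planar (V', E')"
proof -
  obtain p c where d: "plane_drawing (V, E) p c"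
    using assms by (auto simp: planar_def)
  have "plane_drawing (V', E') p c"
    unfolding plane_drawing_def fst_conv snd_conv
  proof (intro conjI ballI impI)
    show "inj_on p V'"
      using d assms(2) by (auto simp: plane_drawing_def intro: inj_on_subset)
    fix e assume e: "e \<in> E'"
    then have eE: "e \<in> E"
      using assms by blast
    show "arc (c e)" "{pathstart (c e), pathfinish (c e)} = p ` e"
      using d eE by (auto simp: plane_drawing_def)
    have "path_image (c e) \<inter> p ` V = p ` e"
      using d eE by (auto simp: plane_drawing_def)
    then show "path_image (c e) \<inter> p ` V' = p ` e"
      using assms(2) assms(4)[OF e] by blast
    fix e' assume "e' \<in> E'" "e \<noteq> e'"
    then show "path_image (c e) \<inter> path_image (c e') = p ` (e \<inter> e')"
      using d eE subsetD[OF assms(3), of e'] unfolding plane_drawing_def by simp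
  qed
  then show ?thesis
    by (auto simp: planar_def)
qed

text \<open>The curves of \<open>x y\<close> and \<open>y z\<close> are joined to draw the new edge.
  Compared with deleting \<open>y\<close>, one edge is saved, and the count in
  \<open>dominated_7\<close> depends on that edge.\<close>

lemma planar_smooth:
  assumes fin: "finite_simple_graph (V, E)" and pl: "planar (V, E)"
    and e: "{x, y} \<in> E" "{y, z} \<in> E" "x \<noteq> z" "{x, z} \<notin> E"
  shows "planar (V - {y}, insert {x, z} {e \<in> E. y \<notin> e})"
proof -
  obtain p c where d: "plane_drawing (V, E) p c"
    using pl by (auto simp: planar_def)
  interpret drawn_graph V E p c
    using fin d by (rule drawn_graphI)
  have V: "x \<in> V" "y \<in> V" "z \<in> V" "x \<noteq> y" "y \<noteq> z"
    using edgeD e by blast+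
  obtain g where g: "arc g" "pathstart g = p x" "pathfinish g = p z" "path_image g = im x y \<union> im y z"
    using path2[OF e(1-3)] .
  define c' where "c' = c({x, z} := g)"
  have gV: "path_image g \<inter> p ` (V - {y}) = p ` {x, z}"
    using V im_pos[OF e(1)] im_pos[OF e(2)] unfolding g(4) by auto
  have gI: "path_image g \<inter> path_image (c f) = p ` ({x, z} \<inter> f)" if f: "f \<in> E" "y \<notin> f" for f
  proof -
    have "im x y \<inter> path_image (c f) = p ` ({x, y} \<inter> f)" "im y z \<inter> path_image (c f) = p ` ({y, z} \<inter> f)"
      using f e by - (rule im_Int; auto)+
    moreover have "{x, y} \<inter> f \<union> {y, z} \<inter> f = {x, z} \<inter> f"
      using f by auto
    ultimately show ?thesis
      unfolding g(4) Int_Un_distrib2 by (metis image_Un)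
  qed
  have eV: "path_image (c f) \<inter> p ` (V - {y}) = p ` f" if f: "f \<in> E" "y \<notin> f" for f
  proof -
    have "path_image (c f) \<inter> p ` V = p ` f" "f \<subseteq> V"
      using d f edge_sub by (auto simp: plane_drawing_def)
    then show ?thesis
      using f by blast
  qed
  have "plane_drawing (V - {y}, insert {x, z} {e \<in> E. y \<notin> e}) p c'"
    unfolding plane_drawing_def fst_conv snd_conv
  proof (intro conjI ballI impI)
    show "inj_on p (V - {y})"
      using d by (auto simp: plane_drawing_def intro: inj_on_subset)
    fix f assume f: "f \<in> insert {x, z} {e \<in> E. y \<notin> e}"
    show "arc (c' f)" "{pathstart (c' f), pathfinish (c' f)} = p ` f"
      using f e g d by (auto simp: c'_def plane_drawing_def)
    show "path_image (c' f) \<inter> p ` (V - {y}) = p ` f"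
    proof (cases "f = {x, z}")
      case True
      then show ?thesis
        using gV by (simp add: c'_def)
    next
      case False
      then show ?thesis
        using f eV by (simp add: c'_def)
    qed
    fix f' assume f': "f' \<in> insert {x, z} {e \<in> E. y \<notin> e}" "f \<noteq> f'"
    consider "f = {x, z}" "f' \<in> E" "y \<notin> f'" "f' \<noteq> {x, z}" | "f' = {x, z}" "f \<in> E" "y \<notin> f" "f \<noteq> {x, z}"
      | "f \<in> E" "f' \<in> E" "f \<noteq> {x, z}" "f' \<noteq> {x, z}"
      using f f' e by auto
    then show "path_image (c' f) \<inter> path_image (c' f') = p ` (f \<inter> f')"
    proof cases
      case 1
      then show ?thesis
        using gI by (simp add: c'_def)
    next
      case 2
      then show ?thesis
        using gI[of f] by (simp add: c'_def Int_commute)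
    next
      case 3
      then show ?thesis
        using im_Int f'(2) by (simp add: c'_def)
    qed
  qed
  then show ?thesis
    by (auto simp: planar_def)
qed

subsection \<open>Neighbourhoods and the double star\<close>

lemma card_filter_split:
  assumes "finite A"
  shows "card A = card {x \<in> A. P x} + card {x \<in> A. \<not> P x}"
proof -
  have "A = {x \<in> A. P x} \<union> {x \<in> A. \<not> P x}"
    by blast
  moreover have "card ({x \<in> A. P x} \<union> {x \<in> A. \<not> P x}) = card {x \<in> A. P x} + card {x \<in> A. \<not> P x}"
    using assms by (intro card_Un_disjoint) auto
  ultimately show ?thesis
    by simp
qed

locale simple_graph =
  fixes V :: "'a set" and E :: "'a set set"
  assumes simple: "finite_simple_graph (V, E)"
begin

lemma finite_V [simp]: "finite V"
  using simple by (simp add: finite_simple_graph_def)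

lemma edge: "e \<in> E \<Longrightarrow> e \<subseteq> V \<and> card e = 2"
  using simple by (simp add: finite_simple_graph_def)

lemma finite_E [simp]: "finite E"
  by (rule finite_subset[of _ "Pow V"]) (use edge in auto)

definition nb :: "'a \<Rightarrow> 'a set" where
  "nb v = {w. {v, w} \<in> E}"

definition deg :: "'a \<Rightarrow> nat" where
  "deg v = card (nb v)"

lemma nb_iff: "w \<in> nb v \<longleftrightarrow> {v, w} \<in> E"
  by (simp add: nb_def)

lemma nb_sym: "w \<in> nb v \<longleftrightarrow> v \<in> nb w"
  by (simp add: nb_def insert_commute)

lemma nb_irrefl [simp]: "v \<notin> nb v"
  using edge[of "{v}"] by (auto simp: nb_def)

lemma nb_subset: "nb v \<subseteq> V"
  using edge by (auto simp: nb_def)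

lemma finite_nb [simp]: "finite (nb v)"
  using nb_subset finite_V by (rule finite_subset)

lemma nb_in_V: "w \<in> nb v \<Longrightarrow> w \<in> V \<and> v \<in> V"
  using nb_subset nb_sym by blast

lemma edge_cases:
  assumes "e \<in> E"
  obtains v w where "e = {v, w}" "v \<noteq> w" "v \<in> V" "w \<in> V" "w \<in> nb v"
proof -
  obtain v w where "e = {v, w}" "v \<noteq> w"
    using edge[OF assms] by (meson card_2_iff)
  then show ?thesis
    using that assms edge[OF assms] by (auto simp: nb_def)
qed

lemma incident_eq: "{e \<in> E. v \<in> e} = (\<lambda>w. {v, w}) ` nb v"
proof -
  have "e \<in> (\<lambda>w. {v, w}) ` nb v" if e: "e \<in> E" "v \<in> e" for e
  proof -
    obtain a b where "e = {a, b}" "a \<noteq> b"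
      using edge_cases[OF e(1)] by metis
    then show ?thesis
      using e by (auto simp: nb_def image_iff insert_commute)
  qed
  then show ?thesis
    by (auto simp: nb_def)
qed

lemma card_incident: "card {e \<in> E. v \<in> e} = deg v"
  unfolding incident_eq deg_def by (rule card_image) (auto simp: inj_on_def doubleton_eq_iff)

lemma handshake: "(\<Sum>v\<in>V. deg v) = 2 * card E"
proof -
  have "card {v \<in> V. v \<in> e} = 2" if "e \<in> E" for e
  proof -
    have "{v \<in> V. v \<in> e} = e"
      using edge[OF that] by auto
    then show ?thesis
      using edge[OF that] by simp
  qed
  then have "(\<Sum>v\<in>V. card {e \<in> E. v \<in> e}) = 2 * card E"
    by (intro sum_multicount) auto
  then show ?thesis
    by (simp add: card_incident)
qed

lemma finite_simple_delete: "finite_simple_graph (V - S, {e \<in> E. e \<inter> S = {}})"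
  using simple by (auto simp: finite_simple_graph_def)

lemma card_edges_split: "card E = card {e \<in> E. e \<inter> S = {}} + card {e \<in> E. e \<inter> S \<noteq> {}}"
  using card_filter_split[OF finite_E] .

text \<open>Let \<open>A\<close> and \<open>B\<close> be the neighbours of \<open>u\<close> and
  \<open>v\<close> other than \<open>v\<close> and \<open>u\<close>. The two leaves at
  \<open>v\<close> are taken outside \<open>A\<close> as far as possible; the bounds 4, 2 and 6 on
  the sizes of \<open>A\<close>, \<open>B\<close> and their union then leave four leaves for
  \<open>u\<close>.\<close>

lemma double_star_copy:
  assumes uv: "v \<in> nb u" and u: "5 \<le> deg u" and v: "3 \<le> deg v" and un: "8 \<le> card (nb u \<union> nb v)"
  shows "contains_copy (V, E) (double_star 2 4)"
proof -
  let ?A = "nb u - {v}" and ?B = "nb v - {u}"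
  have cA: "4 \<le> card ?A" and cB: "2 \<le> card ?B"
    using u v uv nb_sym[of u v] by (auto simp: deg_def)
  have "nb u \<union> nb v = insert u (insert v (?A \<union> ?B))"
    using uv nb_sym[of u v] by auto
  then have cAB: "6 \<le> card (?A \<union> ?B)"
    using un by (simp add: card_insert_if split: if_splits)
  have "\<exists>L. L \<subseteq> ?B \<and> card L = 2 \<and> 4 \<le> card (?A - L)"
  proof -
    \<comment> \<open>Truncated subtraction covers both cases: \<open>A\<close> loses nothing if
      \<open>B\<close> has two elements outside \<open>A\<close>, and otherwise only as many as are
      lacking there.\<close>
    obtain L where L: "L \<subseteq> ?B" "card L = 2" "card (L \<inter> ?A) = 2 - card (?B - ?A)"
    proof (cases "2 \<le> card (?B - ?A)")
      case True
      then obtain L where L: "L \<subseteq> ?B - ?A" "card L = 2"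
        by (meson obtain_subset_with_card_n)
      have "L \<inter> ?A = {}"
        using L by auto
      then show ?thesis
        using that[of L] L True by auto
    next
      case False
      have "card ?B = card (?B \<inter> ?A) + card (?B - ?A)"
        by (rule card_Int_Diff) simp
      then have "2 - card (?B - ?A) \<le> card (?B \<inter> ?A)"
        using cB by simp
      then obtain M where M: "M \<subseteq> ?B \<inter> ?A" "card M = 2 - card (?B - ?A)"
        by (meson obtain_subset_with_card_n)
      have fM: "finite M"
        using M(1) by (rule finite_subset) simp
      have "card (M \<union> (?B - ?A)) = card M + card (?B - ?A)"
        using M fM by (intro card_Un_disjoint) auto
      moreover have "(M \<union> (?B - ?A)) \<inter> ?A = M"
        using M by auto
      ultimately show ?thesis
        using that[of "M \<union> (?B - ?A)"] M False by auto
    qed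
    have "card (?A \<union> ?B) = card (?A \<union> (?B - ?A))"
      by (simp only: Un_Diff_cancel)
    also have "\<dots> = card ?A + card (?B - ?A)"
      by (rule card_Un_disjoint) auto
    finally have "card (?A \<union> ?B) = card ?A + card (?B - ?A)" .
    moreover have "card ?A = card (L \<inter> ?A) + card (?A - L)"
      using card_Int_Diff[of ?A L] by (simp add: Int_commute)
    ultimately show ?thesis
      using L cA cAB by (intro exI[of _ L]) auto
  qed
  then obtain L R where L: "L \<subseteq> ?B" "card L = 2" and R: "R \<subseteq> ?A - L" "card R = 4"
    by (meson obtain_subset_with_card_n)
  obtain ls where ls: "set ls = L" "distinct ls" "length ls = 2"
    using L by (metis card.infinite distinct_card finite_distinct_list zero_neq_numeral)
  obtain rs where rs: "set rs = R" "distinct rs" "length rs = 4"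
    using R by (metis card.infinite distinct_card finite_distinct_list zero_neq_numeral)
  \<comment> \<open>\<open>double_star 2 4\<close> has its two-leaf centre at 0, so \<open>v\<close>
    comes before \<open>u\<close> and the two leaves before the four.\<close>
  define xs where "xs = v # u # ls @ rs"
  have xs: "distinct xs" "length xs = 8" "set xs \<subseteq> V"
    using ls rs L R uv nb_in_V[OF uv] nb_subset unfolding xs_def by auto
  have ds: "double_star 2 4 = ({..<8::nat}, {{0, 1}} \<union> {{0, i} | i. i \<in> {2..<4}} \<union> {{1, i} | i. i \<in> {4..<8}})"
    by (simp add: double_star_def)
  have nth0: "xs ! 0 = v" "xs ! 1 = u"
    by (simp_all add: xs_def)
  have "xs ! i \<in> L" if "i \<in> {2..<4}" for i
  proof -
    have "xs ! i = ls ! (i - 2)" "i - 2 < length ls"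
      using that ls by (auto simp: xs_def nth_append nth_Cons' numeral_eq_Suc)
    then show ?thesis
      using ls nth_mem[of "i - 2" ls] by simp
  qed
  moreover have "xs ! i \<in> R" if "i \<in> {4..<8}" for i
  proof -
    have "xs ! i = rs ! (i - 4)" "i - 4 < length rs"
      using that ls rs by (auto simp: xs_def nth_append nth_Cons' numeral_eq_Suc)
    then show ?thesis
      using rs nth_mem[of "i - 4" rs] by simp
  qed
  ultimately have mem: "i \<in> {2..<4} \<Longrightarrow> {v, xs ! i} \<in> E" "i \<in> {4..<8} \<Longrightarrow> {u, xs ! i} \<in> E" for i
    using L R by (auto simp: nb_def)
  have vu: "{v, u} \<in> E"
    using uv by (simp add: nb_def insert_commute)
  show ?thesis
    unfolding contains_copy_def ds fst_conv snd_conv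
  proof (intro exI[of _ "\<lambda>i. xs ! i"] conjI ballI)
    show "inj_on ((!) xs) {..<8}"
      using xs by (simp add: inj_on_def nth_eq_iff_index_eq)
    show "(!) xs ` {..<8} \<subseteq> V"
      using xs nth_mem[of _ xs] by auto
    fix e :: "nat set"
    assume "e \<in> {{0, 1}} \<union> {{0, i} |i. i \<in> {2..<4}} \<union> {{1, i} |i. i \<in> {4..<8}}"
    then show "(!) xs ` e \<in> E"
      using mem vu nth0 by auto
  qed
qed

end

lemma contains_copy_mono:
  assumes "contains_copy (V', E') H" "V' \<subseteq> V" "E' \<subseteq> E"
  shows "contains_copy (V, E) H"
proof -
  obtain f where "inj_on f (verts H)" "f ` verts H \<subseteq> V'" "\<forall>e \<in> edges H. f ` e \<in> E'"
    using assms(1) by (auto simp: contains_copy_def)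
  then show ?thesis
    unfolding contains_copy_def fst_conv snd_conv using assms(2,3) by (intro exI[of _ f]) blast
qed

subsection \<open>Planar graphs with a dominating vertex\<close>

text \<open>At most 10 - 8 = 2 pairs are missing below \<open>u\<close>. If one vertex lies in all
  missing pairs, its removal leaves K5. Otherwise there are two disjoint missing pairs; adding
  \<open>u\<close> to one and the fifth vertex \<open>h\<close> to the other gives the two sides of
  a K33, since the missing pairs lie within the sides.\<close>

lemma no_dominated_5:
  assumes fg: "finite_simple_graph (V, E)" and pl: "planar (V, E)"
    and V: "card V = 6" "u \<in> V" "\<And>v. v \<in> V - {u} \<Longrightarrow> {u, v} \<in> E"
    and many: "8 \<le> card {e \<in> E. u \<notin> e}"
  shows False
proof -
  interpret simple_graph V E
    using fg by unfold_locales
  let ?W = "V - {u}"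
  have W: "card ?W = 5" "finite ?W"
    using V by auto
  define P where "P = {e. e \<subseteq> ?W \<and> card e = 2}"
  define M where "M = P - E"
  have "card P = 10"
    using n_subsets[OF W(2), of 2] W(1) by (simp add: P_def choose_two)
  have finP: "finite P"
    unfolding P_def by (rule finite_subset[of _ "Pow ?W"]) (use W in auto)
  have "{e \<in> E. u \<notin> e} \<subseteq> P"
    using edge by (auto simp: P_def)
  then have "card (P - {e \<in> E. u \<notin> e}) \<le> 2"
    using many \<open>card P = 10\<close> finP by (subst card_Diff_subset) (auto intro: finite_subset)
  moreover have "P - {e \<in> E. u \<notin> e} = M"
    by (auto simp: P_def M_def)
  ultimately have cM: "card M \<le> 2"
    by simp
  have finM: "finite M"
    using finP by (simp add: M_def)
  have adj: "{x, y} \<in> E" if "x \<in> V" "y \<in> V" "x \<noteq> y" "{x, y} \<notin> M" for x y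
  proof (cases "x = u \<or> y = u")
    case True
    then show ?thesis
      using V(3)[of x] V(3)[of y] that by (auto simp: insert_commute)
  next
    case False
    then have "{x, y} \<in> P"
      using that by (auto simp: P_def)
    then show ?thesis
      using that by (auto simp: M_def)
  qed
  show False
  proof (cases "\<exists>y\<in>?W. \<forall>e\<in>M. y \<in> e")
    case True
    then obtain y where y: "y \<in> ?W" "\<forall>e\<in>M. y \<in> e"
      by blast
    show False
    proof (rule planar_no_K5[OF fg pl])
      show "card (V - {y}) = 5"
        using y V by simp
      show "{a, b} \<in> E" if "a \<in> V - {y}" "b \<in> V - {y}" "a \<noteq> b" for a b
      proof (rule adj)
        show "{a, b} \<notin> M"
        proof
          assume "{a, b} \<in> M"
          then have "y \<in> {a, b}"
            by (rule bspec[OF y(2)])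
          then show False
            using that by auto
        qed
      qed (use that in auto)
    qed
  next
    case False
    have "?W \<noteq> {}"
      using W(1) by (metis card.empty zero_neq_numeral)
    then obtain e1 where e1: "e1 \<in> M"
      using False by auto
    have e1': "e1 \<subseteq> ?W" "card e1 = 2"
      using e1 by (auto simp: M_def P_def)
    \<comment> \<open>If all missing pairs met \<open>e1\<close>, one avoiding \<open>a\<close>
      would contain \<open>b\<close> and one avoiding \<open>b\<close> would contain
      \<open>a\<close>; with \<open>e1\<close> these would be three missing pairs.\<close>
    have "\<exists>e2\<in>M. e1 \<inter> e2 = {}"
    proof (rule ccontr)
      assume *: "\<not> (\<exists>e2\<in>M. e1 \<inter> e2 = {})"
      obtain a b where ab: "e1 = {a, b}" "a \<noteq> b"
        using e1'(2) by (auto simp: card_2_iff)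
      obtain f where f: "f \<in> M" "a \<notin> f"
        using False ab e1' by auto
      obtain g where g: "g \<in> M" "b \<notin> g"
        using False ab e1' by auto
      have "f \<noteq> e1" "g \<noteq> e1" "f \<noteq> g"
        using f g ab * by auto
      then have "card {e1, f, g} = 3"
        by simp
      then have "3 \<le> card M"
        using card_mono[OF finM, of "{e1, f, g}"] e1 f g by simp
      then show False
        using cM by simp
    qed
    then obtain e2 where e2: "e2 \<in> M" "e1 \<inter> e2 = {}"
      by blast
    have e2': "e2 \<subseteq> ?W" "card e2 = 2"
      using e2 by (auto simp: M_def P_def)
    have "e1 \<noteq> e2"
      using e1' e2 by auto
    then have M: "M = {e1, e2}"
      using card_seteq[OF finM, of "{e1, e2}"] e1 e2 cM by simp
    have fin12: "finite e1" "finite e2"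
      using e1' e2' by (auto intro: card_ge_0_finite)
    have c4: "card (e1 \<union> e2) = 4"
      using e1' e2 e2' fin12 by (simp add: card_Un_disjoint)
    have "card (?W - (e1 \<union> e2)) = 1"
      using c4 W e1' e2' fin12 by (subst card_Diff_subset) auto
    then obtain h where h: "?W - (e1 \<union> e2) = {h}"
      by (auto simp: card_1_singleton_iff)
    have h': "h \<in> V" "h \<noteq> u" "h \<notin> e1" "h \<notin> e2"
      using h by auto
    have u: "u \<notin> e1" "u \<notin> e2"
      using e1'(1) e2'(1) by auto
    show False
    proof (rule planar_no_K33[OF fg pl])
      show "card (insert u e1) = 3" "card (insert h e2) = 3"
        using e1'(2) e2'(2) h'(3,4) u fin12 by simp_all
      show "insert u e1 \<inter> insert h e2 = {}"
        using u e2(2) h' by auto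
      show "{a, b} \<in> E" if "a \<in> insert u e1" "b \<in> insert h e2" for a b
      proof (rule adj)
        show "a \<in> V" "b \<in> V" "a \<noteq> b"
          using that e1'(1) e2'(1) e2(2) h' V(2) u by auto
        show "{a, b} \<notin> M"
        proof
          assume "{a, b} \<in> M"
          then have "a \<in> e1 \<and> b \<in> e1 \<or> a \<in> e2 \<and> b \<in> e2"
            unfolding M by (metis insertCI insertE singletonD)
          then show False
            using that e2(2) u h' by blast
        qed
      qed
    qed
  qed
qed

text \<open>With 16 edges, at least 10 would avoid \<open>u\<close>. If some \<open>y\<close> has at
  most three neighbours besides \<open>u\<close>, then either it has two nonadjacent ones and is
  suppressed, or three adjacent ones form K5 with \<open>u\<close> and \<open>y\<close>, or there
  are at most two and deleting \<open>y\<close> keeps 10 - 2 = 8 edges. If all have at least four,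
  two nonadjacent vertices draw theirs from the same four, which gives K33 with \<open>u\<close>;
  without such a pair there is a K5.\<close>

lemma dominated_7:
  assumes fg: "finite_simple_graph (V, E)" and pl: "planar (V, E)"
    and V: "card V = 7" "u \<in> V" "\<And>v. v \<in> V - {u} \<Longrightarrow> {u, v} \<in> E"
  shows "card E \<le> 15"
proof (rule ccontr)
  assume many: "\<not> card E \<le> 15"
  interpret simple_graph V E
    using fg by unfold_locales
  let ?W = "V - {u}"
  have W: "card ?W = 6" "finite ?W"
    using V by auto
  have nbu: "nb u = ?W"
  proof
    show "nb u \<subseteq> ?W"
      using nb_subset nb_irrefl by blast
    show "?W \<subseteq> nb u"
      using V(3) by (simp add: nb_iff subset_iff)
  qed
  have "card E = card {e \<in> E. u \<notin> e} + card {e \<in> E. u \<in> e}"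
    using card_filter_split[OF finite_E, of "\<lambda>e. u \<notin> e"] by simp
  then have ten: "10 \<le> card {e \<in> E. u \<notin> e}"
    using many card_incident[of u] W by (simp add: deg_def nbu)
  show False
  proof (cases "\<exists>y\<in>?W. card (nb y - {u}) \<le> 3")
    case True
    then obtain y where y: "y \<in> ?W" "card (nb y - {u}) \<le> 3"
      by blast
    let ?Y = "nb y - {u}"
    have cV: "card (V - {y}) = 6" "u \<in> V - {y}" "\<And>v. v \<in> V - {y} - {u} \<Longrightarrow> {u, v} \<in> {e \<in> E. y \<notin> e}"
      using V y by auto
    have "{e \<in> E. u \<notin> e} = {e \<in> E. u \<notin> e \<and> y \<notin> e} \<union> (\<lambda>w. {y, w}) ` ?Y" (is "_ = ?L \<union> ?R")
    proof -
      have "{e \<in> E. u \<notin> e \<and> y \<in> e} = {e \<in> E. y \<in> e} - {{y, u}}"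
      proof -
        have "e = {y, u}" if "e \<in> E" "y \<in> e" "u \<in> e" for e
          using edge_cases[OF that(1)] that y by auto
        then show ?thesis
          using y by auto
      qed
      also have "\<dots> = (\<lambda>w. {y, w}) ` ?Y"
        unfolding incident_eq by (auto simp: doubleton_eq_iff)
      finally show ?thesis
        by auto
    qed
    moreover have "card ?R = card ?Y"
      by (rule card_image) (auto simp: inj_on_def doubleton_eq_iff)
    ultimately have "card {e \<in> E. u \<notin> e} \<le> card ?L + card ?Y"
      using card_Un_le[of ?L ?R] by simp
    then have L: "10 \<le> card ?L + card ?Y"
      using ten by simp
    have del: "finite_simple_graph (V - {y}, {e \<in> E. y \<notin> e})"
      using finite_simple_delete[of "{y}"] by simp
    show False
    proof (cases "\<exists>x\<in>?Y. \<exists>z\<in>?Y. x \<noteq> z \<and> {x, z} \<notin> E")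
      case True
      then obtain x z where xz: "x \<in> ?Y" "z \<in> ?Y" "x \<noteq> z" "{x, z} \<notin> E"
        by blast
      then have e: "{x, y} \<in> E" "{y, z} \<in> E" "x \<noteq> y" "z \<noteq> y" "x \<in> V" "z \<in> V"
        using nb_iff[of x y] nb_iff[of z y] nb_in_V by (auto simp: insert_commute)
      \<comment> \<open>At least 10 - 3 edges avoiding \<open>u\<close> survive the loss of
        \<open>y\<close>; the new edge supplies the eighth.\<close>
      let ?E = "insert {x, z} {e \<in> E. y \<notin> e}"
      show False
      proof (rule no_dominated_5[of "V - {y}" ?E u])
        show "finite_simple_graph (V - {y}, ?E)"
          using del e xz by (auto simp: finite_simple_graph_def)
        show "planar (V - {y}, ?E)"
          using fg pl e(1,2) xz(3,4) by (rule planar_smooth)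
        have "{e \<in> ?E. u \<notin> e} = insert {x, z} ?L"
          using xz by auto
        then have "card {e \<in> ?E. u \<notin> e} = Suc (card ?L)"
          using xz by simp
        then show "8 \<le> card {e \<in> ?E. u \<notin> e}"
          using L y by simp
      qed (use cV in auto)
    next
      case clique: False
      show False
      proof (cases "card ?Y = 3")
        case True
        show False
        proof (rule planar_no_K5[OF fg pl])
          show "card (insert u (insert y ?Y)) = 5"
            using True y by auto
          show "{a, b} \<in> E" if ab: "a \<in> insert u (insert y ?Y)" "b \<in> insert u (insert y ?Y)" "a \<noteq> b" for a b
          proof -
            have sub: "a \<in> V" "b \<in> V"
              using ab y V(2) nb_subset by auto
            consider "a = u \<or> b = u" | "a = y" "b \<in> ?Y" | "b = y" "a \<in> ?Y" | "a \<in> ?Y" "b \<in> ?Y"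
              using ab by auto
            then show ?thesis
            proof cases
              case 1
              then show ?thesis
                using V(3)[of a] V(3)[of b] sub ab by (auto simp: insert_commute)
            next
              case 4
              then show ?thesis
                using clique ab by blast
            qed (auto simp: nb_iff insert_commute)
          qed
        qed
      next
        case False
        show False
        proof (rule no_dominated_5[OF del _ cV])
          show "planar (V - {y}, {e \<in> E. y \<notin> e})"
            using pl by (rule planar_subgraph) (use edge in auto)
          have "{e \<in> {e \<in> E. y \<notin> e}. u \<notin> e} = ?L"
            by auto
          then show "8 \<le> card {e \<in> {e \<in> E. y \<notin> e}. u \<notin> e}"
            using L y(2) False by simp
        qed auto
      qed
    qed
  next
    case False
    show False
    proof (cases "\<exists>a\<in>?W. \<exists>b\<in>?W. a \<noteq> b \<and> {a, b} \<notin> E")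
      case True
      then obtain a b where ab: "a \<in> ?W" "b \<in> ?W" "a \<noteq> b" "{a, b} \<notin> E"
        by blast
      let ?A = "nb a - {u}" and ?B = "nb b - {u}"
      have "?A \<union> ?B \<subseteq> ?W - {a, b}"
        using nb_subset ab nb_irrefl by (auto simp: nb_iff insert_commute)
      then have "card (?A \<union> ?B) \<le> card (?W - {a, b})"
        using W(2) by (intro card_mono) auto
      also have "\<dots> = 4"
        using ab W by (subst card_Diff_subset) auto
      finally have "card (?A \<union> ?B) \<le> 4" .
      moreover have "4 \<le> card ?A" "4 \<le> card ?B"
        using False ab by force+
      moreover have "card ?A + card ?B = card (?A \<union> ?B) + card (?A \<inter> ?B)"
        by (rule card_Un_Int) auto
      ultimately have "3 \<le> card (?A \<inter> ?B)"
        by linarith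
      then obtain C where C: "C \<subseteq> ?A \<inter> ?B" "card C = 3"
        by (meson obtain_subset_with_card_n)
      show False
      proof (rule planar_no_K33[OF fg pl _ C(2)])
        show "card {u, a, b} = 3"
          using ab by auto
        show "{u, a, b} \<inter> C = {}"
          using C ab nb_irrefl by auto
        show "{x, y} \<in> E" if "x \<in> {u, a, b}" "y \<in> C" for x y
        proof -
          have y: "y \<in> nb a" "y \<in> nb b" "y \<in> V - {u}"
            using C(1) that(2) nb_subset by blast+
          then show ?thesis
            using that(1) V(3)[OF y(3)] by (auto simp: nb_iff)
        qed
      qed
    next
      case clique: False
      obtain K where K: "K \<subseteq> ?W" "card K = 5"
        using W obtain_subset_with_card_n[of 5 ?W] by auto
      show False
        by (rule planar_no_K5[OF fg pl K(2)]) (use clique K in blast)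
    qed
  qed
qed

subsection \<open>Vertices of degree 5\<close>

text \<open>This is what the reductions leave of a minimal counterexample. Planarity enters only
  through the two excluded subgraphs, so the rest is purely combinatorial.\<close>

locale star_free_graph = simple_graph V E for V :: "'a set" and E :: "'a set set" +
  assumes deg_ge: "v \<in> V \<Longrightarrow> 3 \<le> deg v" and deg_le: "v \<in> V \<Longrightarrow> deg v \<le> 5"
    and union_le: "v \<in> nb u \<Longrightarrow> deg u = 5 \<Longrightarrow> card (nb u \<union> nb v) \<le> 7"
    and K33_free: "card A = 3 \<Longrightarrow> card B = 3 \<Longrightarrow> A \<inter> B = {} \<Longrightarrow>
      (\<And>a b. a \<in> A \<Longrightarrow> b \<in> B \<Longrightarrow> b \<in> nb a) \<Longrightarrow> False"
    and K5_free: "card K = 5 \<Longrightarrow> (\<And>x y. x \<in> K \<Longrightarrow> y \<in> K \<Longrightarrow> x \<noteq> y \<Longrightarrow> y \<in> nb x) \<Longrightarrow> False"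
begin

definition F :: "'a set" where
  "F = {v \<in> V. deg v = 5}"

lemma F_D: "u \<in> F \<Longrightarrow> u \<in> V \<and> card (nb u) = 5"
  by (simp add: F_def deg_def)

lemma finite_F [simp]: "finite F"
  by (simp add: F_def)

text \<open>The closed neighbourhood of \<open>u\<close> has 6 elements and lies in
  \<open>nb u \<union> nb v\<close>, which has at most 7.\<close>

lemma nb_outside_le_1:
  assumes "u \<in> F" "v \<in> nb u"
  shows "card (nb v - insert u (nb u)) \<le> 1"
proof -
  let ?X = "insert u (nb u)" and ?Y = "nb v - insert u (nb u)"
  have "u \<in> nb v"
    using assms nb_sym by blast
  then have "?X \<union> ?Y \<subseteq> nb u \<union> nb v"
    by auto
  then have "card (?X \<union> ?Y) \<le> card (nb u \<union> nb v)"
    by (intro card_mono) auto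
  also have "\<dots> \<le> 7"
    using union_le assms by (simp add: F_def)
  finally have "card (?X \<union> ?Y) \<le> 7" .
  moreover have "card (?X \<union> ?Y) = card ?X + card ?Y"
    by (rule card_Un_disjoint) auto
  moreover have "card ?X = 6"
    using F_D[OF assms(1)] by simp
  ultimately show ?thesis
    by simp
qed

lemma nb_outside_unique:
  assumes "u \<in> F" "v \<in> nb u" "x \<in> nb v" "y \<in> nb v" "x \<notin> insert u (nb u)" "y \<notin> insert u (nb u)"
  shows "x = y"
proof (rule ccontr)
  assume "x \<noteq> y"
  then have "card {x, y} = 2"
    by simp
  moreover have "{x, y} \<subseteq> nb v - insert u (nb u)"
    using assms by auto
  then have "card {x, y} \<le> card (nb v - insert u (nb u))"
    by (intro card_mono) auto
  ultimately show False
    using nb_outside_le_1[OF assms(1,2)] by simp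
qed

text \<open>Inclusion-exclusion: 5 + 5 - 7.\<close>

lemma common_nb:
  assumes "u \<in> F" "v \<in> F" "v \<in> nb u"
  shows "3 \<le> card (nb u \<inter> nb v)"
proof -
  have "card (nb u) + card (nb v) = card (nb u \<union> nb v) + card (nb u \<inter> nb v)"
    by (rule card_Un_Int) auto
  moreover have "card (nb u \<union> nb v) \<le> 7"
    using union_le assms by (simp add: F_def)
  ultimately show ?thesis
    using F_D assms by fastforce
qed

text \<open>If \<open>u\<close> and \<open>w\<close> were not adjacent, each of them would have to
  share with \<open>v\<close> all three vertices of \<open>S\<close>, the neighbours of
  \<open>v\<close> other than \<open>u\<close> and \<open>w\<close>. Then \<open>{u, v, w}\<close>
  and \<open>S\<close> span a K33.\<close>

lemma F_trans:
  assumes "u \<in> F" "v \<in> F" "w \<in> F" "v \<in> nb u" "w \<in> nb v" "w \<noteq> u"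
  shows "w \<in> nb u"
proof (rule ccontr)
  assume w: "w \<notin> nb u"
  define S where "S = nb v - {u, w}"
  have uv: "u \<in> nb v"
    using assms nb_sym by blast
  have "card S = 3"
    unfolding S_def using assms uv F_D[OF assms(2)] by (subst card_Diff_subset) auto
  have "finite S"
    by (simp add: S_def)
  have eq: "nb x \<inter> nb v = S" if "x = u \<or> x = w" for x
  proof (rule card_seteq)
    have "w \<notin> nb w" "u \<notin> nb w"
      using w nb_sym by auto
    then show "nb x \<inter> nb v \<subseteq> S"
      using that w by (auto simp: S_def)
    have "x \<in> F" "v \<in> nb x"
      using that assms nb_sym by auto
    then show "card S \<le> card (nb x \<inter> nb v)"
      using common_nb[of x v] assms \<open>card S = 3\<close> by simp
  qed fact
  show False
  proof (rule K33_free[OF _ \<open>card S = 3\<close>])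
    show "card {u, v, w} = 3"
      using assms uv nb_irrefl by (auto simp: card_insert_if)
    show "{u, v, w} \<inter> S = {}"
      by (auto simp: S_def)
    show "b \<in> nb a" if "a \<in> {u, v, w}" "b \<in> S" for a b
      using that eq[of u] eq[of w] by (auto simp: S_def)
  qed
qed

text \<open>Suppose \<open>u'\<close> lies outside. Seen from \<open>u\<close> it is the only outer
  neighbour of \<open>t\<close>, and seen from \<open>u'\<close> that is \<open>u\<close>; so all
  other neighbours of \<open>t\<close> are common to \<open>u\<close> and \<open>u'\<close>, and
  there is one, \<open>s\<close>, because \<open>t\<close> has degree at least 3. Neither
  \<open>s\<close> nor \<open>t\<close> is adjacent to \<open>v\<close>, since \<open>v\<close>
  would then be adjacent to \<open>u'\<close> and transitivity would put \<open>u'\<close> next to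
  \<open>u\<close>. This leaves \<open>u\<close> and \<open>v\<close> at most two common
  neighbours.\<close>

lemma no_shared_nb:
  assumes uv: "u \<in> F" "v \<in> F" "v \<in> nb u" and t: "t \<in> nb u" and u': "u' \<in> F" "u' \<in> nb t"
  shows "u' \<in> insert u (nb u)"
proof (rule ccontr)
  assume n: "u' \<notin> insert u (nb u)"
  have n': "u \<notin> insert u' (nb u')"
    using n nb_sym by blast
  have tu: "u \<in> nb t" "t \<in> nb u'"
    using t u' nb_sym by blast+
  have both: "s \<in> nb u \<and> s \<in> nb u'" if "s \<in> nb t" "s \<noteq> u" "s \<noteq> u'" for s
    using nb_outside_unique[OF uv(1) t that(1) u'(2) _ n]
      nb_outside_unique[OF u'(1) tu(2) that(1) tu(1) _ n'] that by auto
  have "u \<noteq> u'"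
    using n by blast
  then have "card {u, u'} = 2"
    by simp
  moreover have "3 \<le> card (nb t)"
    using deg_ge[of t] nb_in_V[OF t] by (simp add: deg_def)
  ultimately have "\<not> nb t \<subseteq> {u, u'}"
    using card_mono[of "{u, u'}" "nb t"] by auto
  then obtain s where s: "s \<in> nb t" "s \<noteq> u" "s \<noteq> u'"
    by blast
  have "x \<notin> nb v" if "x \<in> nb u" "x \<in> nb u'" "\<And>y. y \<in> nb x \<Longrightarrow> y \<noteq> u \<Longrightarrow> y \<noteq> u' \<Longrightarrow> y \<in> nb u'" for x
  proof
    assume "x \<in> nb v"
    moreover have "v \<noteq> u" "v \<noteq> u'"
      using uv n by auto
    ultimately have "v \<in> nb u'"
      using that(3)[of v] nb_sym by blast
    then have "u' \<in> nb v"
      using nb_sym by blast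
    then show False
      using F_trans[OF uv(1,2) u'(1) uv(3)] n by auto
  qed
  moreover have "y \<in> nb u'" if "x \<in> nb u" "x \<in> nb u'" "y \<in> nb x" "y \<noteq> u" "y \<noteq> u'" for x y
  proof -
    have "u \<in> nb x"
      using that(1) nb_sym by blast
    then show ?thesis
      using nb_outside_unique[OF u'(1) that(2,3) _ _ n'] that by auto
  qed
  ultimately have nv: "x \<notin> nb v" if "x \<in> nb u" "x \<in> nb u'" for x
    using that by blast
  have st: "s \<notin> nb v" "t \<notin> nb v" "s \<noteq> t" "s \<in> nb u"
    using nv both[OF s] t tu s nb_irrefl by auto
  have "nb u \<inter> nb v \<subseteq> nb u - {v, s, t}"
    using st nb_irrefl by auto
  then have "card (nb u \<inter> nb v) \<le> card (nb u - {v, s, t})"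
    by (intro card_mono) auto
  also have "\<dots> = 2"
  proof -
    have "v \<noteq> s" "v \<noteq> t"
    proof -
      have "u' \<notin> nb v"
        using F_trans[OF uv(1,2) u'(1) uv(3)] n by auto
      moreover have "u' \<in> nb s" "u' \<in> nb t"
        using both[OF s] u' nb_sym by blast+
      ultimately show "v \<noteq> s" "v \<noteq> t"
        by blast+
    qed
    then show ?thesis
      using uv t st F_D[OF uv(1)] by (subst card_Diff_subset) auto
  qed
  finally show False
    using common_nb[OF uv] by simp
qed

text \<open>Four mutually adjacent vertices \<open>u, v, w, z\<close> of degree 5 whose other neighbours form the
  pattern \<open>ab, bc, ac, ab\<close> force \<open>c\<close> to be adjacent to \<open>a\<close> and \<open>b\<close>, and then
  \<open>a, b, w\<close> and \<open>u, z, c\<close> span a copy of \<open>K\<^sub>3\<^sub>,\<^sub>3\<close>.\<close>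

lemma K4_pattern:
  assumes F: "u \<in> F" "v \<in> F" "w \<in> F" "z \<in> F"
    and dist: "distinct [u, v, w, z, a, b, c]"
    and nbs: "nb u = {v, w, z, a, b}" "nb v = {u, w, z, b, c}" "nb w = {u, v, z, a, c}"
      "nb z = {u, v, w, a, b}"
    and c: "deg c = 4"
  shows False
proof -
  have adj: "v \<in> nb c" "w \<in> nb c" "u \<notin> nb c" "z \<notin> nb c"
    using nb_sym[of c v] nb_sym[of c w] nb_sym[of c u] nb_sym[of c z] dist by (auto simp: nbs)
  have cv: "c \<in> nb v" "c \<in> nb w"
    using nbs by auto
  \<comment> \<open>Of the four neighbours of \<open>c\<close> at most one is outside the closed
    neighbourhood of \<open>x\<close>. At least three are inside, where only \<open>v\<close>,
    \<open>w\<close> and \<open>y\<close> are available.\<close>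
  have key: "y \<in> nb c" if x: "x \<in> F" "c \<in> nb x" and nbx: "insert x (nb x) \<inter> nb c \<subseteq> {v, w, y}" for x y
  proof -
    have "card (nb c) = card (insert x (nb x) \<inter> nb c) + card (nb c - insert x (nb x))"
      using card_Int_Diff[of "nb c" "insert x (nb x)"] by (simp add: Int_commute)
    then have "3 \<le> card (insert x (nb x) \<inter> nb c)"
      using nb_outside_le_1[OF x] c by (simp add: deg_def)
    moreover have "card {v, w} = 2"
      using dist by auto
    ultimately have "\<not> insert x (nb x) \<inter> nb c \<subseteq> {v, w}"
      using card_mono[of "{v, w}" "insert x (nb x) \<inter> nb c"] by auto
    then show ?thesis
      using nbx by auto
  qed
  have cb: "b \<in> nb c"
    by (rule key[OF F(2) cv(1)]) (use nbs adj in auto)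
  have ca: "a \<in> nb c"
    by (rule key[OF F(3) cv(2)]) (use nbs adj in auto)
  show False
  proof (rule K33_free[of "{u, z, c}" "{a, b, w}"])
    show "y \<in> nb x" if "x \<in> {u, z, c}" "y \<in> {a, b, w}" for x y
      using that nbs ca cb adj by auto
  qed (use dist in auto)
qed

subsection \<open>Discharging\<close>

text \<open>These vertices form the cliques of size at least 2. Only for them does
  \<open>no_shared_nb\<close>, which needs an adjacent pair, keep the neighbourhoods apart.\<close>

definition F2 :: "'a set" where
  "F2 = {u \<in> F. nb u \<inter> F \<noteq> {}}"

definition cluster :: "'a \<Rightarrow> 'a set" where
  "cluster u = insert u (nb u \<inter> F)"

definition rim :: "'a set \<Rightarrow> 'a set" where
  "rim C = (\<Union>x\<in>C. nb x) - C"

text \<open>On \<open>F\<close> the subtraction truncates to 0 in place of -4; weights are summed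
  outside \<open>F\<close> only, and the deficit appears separately as
  \<open>4 * card F\<close>.\<close>

definition wt :: "'a \<Rightarrow> nat" where
  "wt t = 31 - 7 * deg t"

lemma finite_cluster [simp]: "finite (cluster u)"
  by (simp add: cluster_def)

lemma rim_subset: "rim C \<subseteq> V"
  using nb_subset by (auto simp: rim_def)

lemma finite_rim [simp]: "finite (rim C)"
  using rim_subset finite_V by (rule finite_subset)

lemma wt_ge: "t \<in> V - F \<Longrightarrow> 3 \<le> wt t"
  using deg_le[of t] by (auto simp: F_def wt_def)

lemma cluster_F: "u \<in> F \<Longrightarrow> cluster u \<subseteq> F"
  by (auto simp: cluster_def)

lemma cluster_adj:
  assumes "u \<in> F" "x \<in> cluster u" "y \<in> cluster u" "x \<noteq> y"
  shows "y \<in> nb x"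
proof (cases "x = u \<or> y = u")
  case True
  then show ?thesis
    using assms nb_sym[of x y] by (auto simp: cluster_def)
next
  case False
  then have "x \<in> F" "y \<in> F" "u \<in> nb x" "y \<in> nb u"
    using assms nb_sym[of u x] by (auto simp: cluster_def)
  then show ?thesis
    using F_trans[of x u y] assms by blast
qed

lemma cluster_eq:
  assumes u: "u \<in> F" and x: "x \<in> cluster u"
  shows "cluster x = cluster u"
proof (cases "x = u")
  case False
  then have xu: "x \<in> F" "x \<in> nb u" "u \<in> nb x"
    using x nb_sym by (auto simp: cluster_def)
  have "cluster a \<subseteq> cluster b" if ab: "a \<in> F" "b \<in> F" "b \<in> nb a" for a b
  proof
    fix y assume y: "y \<in> cluster a"
    have "b \<in> cluster a"
      using ab by (simp add: cluster_def)
    then have "y \<noteq> b \<Longrightarrow> y \<in> nb b"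
      using cluster_adj[OF ab(1)] y by blast
    moreover have "y \<in> F"
      using y cluster_F[OF ab(1)] by blast
    ultimately show "y \<in> cluster b"
      by (auto simp: cluster_def)
  qed
  then show ?thesis
    using u xu by blast
qed simp

lemma cluster_F2:
  assumes "u \<in> F2" "x \<in> cluster u"
  shows "x \<in> F2"
proof (cases "x = u")
  case False
  then have "x \<in> F" "u \<in> nb x" "u \<in> F"
    using assms nb_sym by (auto simp: cluster_def F2_def)
  then show ?thesis
    by (auto simp: F2_def)
qed (use assms in simp)

lemma rim_F:
  assumes "u \<in> F"
  shows "rim (cluster u) \<inter> F = {}"
proof -
  have "t \<in> cluster u" if "x \<in> cluster u" "t \<in> nb x" "t \<in> F" for t x
  proof -
    have "t \<in> cluster x"
      using that by (simp add: cluster_def)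
    then show ?thesis
      using cluster_eq[OF assms that(1)] by simp
  qed
  then show ?thesis
    by (auto simp: rim_def)
qed

lemma shared_same_cluster:
  assumes "u \<in> F2" "u' \<in> F" "t \<in> nb u" "t \<in> nb u'"
  shows "cluster u' = cluster u"
proof -
  obtain v where "v \<in> F" "v \<in> nb u" "u \<in> F"
    using assms(1) by (auto simp: F2_def)
  moreover have "u' \<in> nb t"
    using assms nb_sym by blast
  ultimately have "u' \<in> insert u (nb u)"
    using no_shared_nb[of u v t u'] assms by blast
  then have "u' \<in> cluster u"
    using assms by (auto simp: cluster_def)
  then show ?thesis
    using cluster_eq \<open>u \<in> F\<close> by blast
qed

lemma rim_disjoint:
  assumes "u \<in> F2" "u' \<in> F2" "cluster u \<noteq> cluster u'"
  shows "rim (cluster u) \<inter> rim (cluster u') = {}"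
proof -
  have F: "u \<in> F" "u' \<in> F"
    using assms by (auto simp: F2_def)
  have False if t: "x \<in> cluster u" "t \<in> nb x" "x' \<in> cluster u'" "t \<in> nb x'" for t x x'
  proof -
    have "x' \<in> F"
      using t(3) cluster_F[OF F(2)] by blast
    then have "cluster x' = cluster x"
      using shared_same_cluster[OF cluster_F2[OF assms(1) t(1)] _ t(2,4)] by blast
    then show False
      using cluster_eq[OF F(1) t(1)] cluster_eq[OF F(2) t(3)] assms(3) by simp
  qed
  then show ?thesis
    unfolding rim_def by blast
qed

text \<open>Of the 5 neighbours of \<open>x\<close>, all but one of the cluster's elements
  (\<open>x\<close> itself) are accounted for inside. The sum form avoids truncated
  subtraction.\<close>

lemma card_nb_minus_cluster:
  assumes "u \<in> F" "x \<in> cluster u"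
  shows "card (nb x - cluster u) + card (cluster u) = 6"
proof -
  have "cluster u - {x} \<subseteq> nb x"
    using cluster_adj[OF assms] by blast
  then have "nb x \<inter> cluster u = cluster u - {x}"
    using nb_irrefl by blast
  then have "card (nb x) = card (cluster u - {x}) + card (nb x - cluster u)"
    using card_Int_Diff[of "nb x" "cluster u"] by simp
  moreover have "card (cluster u - {x}) = card (cluster u) - 1" "0 < card (cluster u)"
    using assms by (auto simp: card_gt_0_iff)
  moreover have "card (nb x) = 5"
    using F_D cluster_F assms by blast
  ultimately show ?thesis
    by simp
qed

lemma nb_minus_cluster_subset: "x \<in> cluster u \<Longrightarrow> nb x - cluster u \<subseteq> rim (cluster u)"
  by (auto simp: rim_def)

lemma sum_wt_ge:
  assumes "u \<in> F" "S \<subseteq> rim (cluster u)"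
  shows "3 * card S \<le> sum wt S"
proof -
  have "S \<subseteq> V - F"
    using assms rim_F rim_subset by blast
  then have "(\<Sum>t\<in>S. 3) \<le> sum wt S"
    using wt_ge by (intro sum_mono) blast
  then show ?thesis
    by (simp add: mult.commute)
qed

section \<open>Weight around one cluster\<close>

lemma cluster_card_bounds:
  assumes "u \<in> F2"
  shows "2 \<le> card (cluster u)" "card (cluster u) \<le> 4"
proof -
  have u: "u \<in> F"
    using assms by (simp add: F2_def)
  obtain v where "v \<in> nb u \<inter> F"
    using assms by (auto simp: F2_def)
  then have "{u, v} \<subseteq> cluster u" "u \<noteq> v"
    by (auto simp: cluster_def)
  then show "2 \<le> card (cluster u)"
    using card_mono[of "cluster u" "{u, v}"] by simp
  show "card (cluster u) \<le> 4"
  proof (rule ccontr)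
    assume "\<not> card (cluster u) \<le> 4"
    then obtain K where K: "K \<subseteq> cluster u" "card K = 5"
      using obtain_subset_with_card_n[of 5 "cluster u"] by auto
    show False
      by (rule K5_free[OF K(2)]) (use K cluster_adj[OF u] in blast)
  qed
qed

text \<open>Each member has three neighbours in the rim; if the rim had no others, cluster and rim
  would span a K33.\<close>

lemma rim_3:
  assumes u: "u \<in> F" and c: "card (cluster u) = 3"
  shows "4 \<le> card (rim (cluster u))"
proof (rule ccontr)
  let ?R = "rim (cluster u)"
  assume "\<not> 4 \<le> card ?R"
  moreover have c3: "card (nb x - cluster u) = 3" if "x \<in> cluster u" for x
    using card_nb_minus_cluster[OF u that] c by simp
  ultimately have eq: "nb x - cluster u = ?R" if "x \<in> cluster u" for x
    using that by (intro card_seteq[OF finite_rim nb_minus_cluster_subset[OF that]]) simp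
  have "u \<in> cluster u"
    by (simp add: cluster_def)
  then have "card ?R = 3"
    using c3 eq by metis
  show False
  proof (rule K33_free[OF c \<open>card ?R = 3\<close>])
    show "cluster u \<inter> ?R = {}"
      by (auto simp: rim_def)
    show "b \<in> nb a" if "a \<in> cluster u" "b \<in> ?R" for a b
      using eq[OF that(1)] that(2) by blast
  qed
qed

text \<open>Each member has two outer neighbours. Any two of these pairs meet, as adjacent vertices
  of degree 5 share three neighbours; no vertex is in all of them, by K5. So they are pairs from one
  triple \<open>a\<close>, \<open>b\<close>, \<open>c\<close>, and with four members one pair is
  repeated after all three have occurred. \<open>K4_pattern\<close> then forbids that
  \<open>a\<close>, \<open>b\<close>, \<open>c\<close> all have degree 4, and a degree 3 gives 10 +
  3 + 3 = 16.\<close>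

lemma rim_4:
  assumes u: "u \<in> F" and c: "card (cluster u) = 4"
  shows "16 \<le> sum wt (rim (cluster u))"
proof -
  let ?C = "cluster u"
  let ?R = "rim ?C"
  define N where "N x = nb x - ?C" for x
  have cN: "card (N x) = 2" if "x \<in> ?C" for x
    using card_nb_minus_cluster[OF u that] c by (simp add: N_def)
  have NR: "N x \<subseteq> ?R" if "x \<in> ?C" for x
    using nb_minus_cluster_subset[OF that] by (simp add: N_def)
  have nbN: "nb x = (?C - {x}) \<union> N x" if "x \<in> ?C" for x
    using cluster_adj[OF u that] nb_irrefl unfolding N_def by blast
  \<comment> \<open>Otherwise only the two remaining members of the cluster are common
    neighbours.\<close>
  have meet: "N x \<inter> N y \<noteq> {}" if xy: "x \<in> ?C" "y \<in> ?C" "x \<noteq> y" for x y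
  proof
    assume "N x \<inter> N y = {}"
    then have "nb x \<inter> nb y \<subseteq> ?C - {x, y}"
      using nb_irrefl[of x] nb_irrefl[of y] unfolding N_def by blast
    then have "card (nb x \<inter> nb y) \<le> card (?C - {x, y})"
      by (intro card_mono) auto
    also have "\<dots> = 2"
      using xy c by (subst card_Diff_subset) auto
    finally show False
      using common_nb[of x y] cluster_F[OF u] cluster_adj[OF u xy] xy by force
  qed
  have no_common: "\<exists>x\<in>?C. t \<notin> N x" for t
  proof (rule ccontr)
    assume "\<not> (\<exists>x\<in>?C. t \<notin> N x)"
    then have t: "t \<in> N x" if "x \<in> ?C" for x
      using that by blast
    have "t \<notin> ?C"
      using t[of u] by (auto simp: N_def cluster_def)
    show False
    proof (rule K5_free)
      show "card (insert t ?C) = 5"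
        using c \<open>t \<notin> ?C\<close> by simp
      show "y \<in> nb x" if "x \<in> insert t ?C" "y \<in> insert t ?C" "x \<noteq> y" for x y
        using that t[of x] t[of y] cluster_adj[OF u, of x y] nb_sym[of x y] by (auto simp: N_def)
    qed
  qed
  have uC: "u \<in> ?C"
    by (simp add: cluster_def)
  obtain a b where ab: "N u = {a, b}" "a \<noteq> b"
    using cN[OF uC] by (auto simp: card_2_iff)
  obtain v where v: "v \<in> ?C" "a \<notin> N v"
    using no_common by blast
  obtain w where w: "w \<in> ?C" "b \<notin> N w"
    using no_common by blast
  have "v \<noteq> u" "w \<noteq> u"
    using v w ab by auto
  have "b \<in> N v" "a \<in> N w"
    using meet[OF uC v(1)] meet[OF uC w(1)] v w \<open>v \<noteq> u\<close> \<open>w \<noteq> u\<close> ab by auto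
  have "v \<noteq> w"
    using \<open>b \<in> N v\<close> w by auto
  have "card (N v - {b}) = 1" "card (N w - {a}) = 1"
    using cN[OF v(1)] cN[OF w(1)] \<open>b \<in> N v\<close> \<open>a \<in> N w\<close> by simp_all
  then obtain c d where "N v - {b} = {c}" "N w - {a} = {d}"
    by (auto simp: card_1_singleton_iff)
  then have Nv: "N v = {b, c}" "b \<noteq> c" and Nw: "N w = {a, d}" "a \<noteq> d"
    using \<open>b \<in> N v\<close> \<open>a \<in> N w\<close> by auto
  have "d = c"
    using meet[OF v(1) w(1) \<open>v \<noteq> w\<close>] Nv Nw v w by auto
  with Nw have Nw: "N w = {a, c}" "a \<noteq> c"
    by auto
  have abc: "distinct [a, b, c]" "{a, b, c} \<subseteq> ?R"
    using ab Nv Nw NR[OF uC] NR[OF v(1)] by auto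
  have "card (?C - {u, v, w}) = 1"
    using uC v(1) w(1) \<open>v \<noteq> u\<close> \<open>w \<noteq> u\<close> \<open>v \<noteq> w\<close> \<open>card ?C = 4\<close> by (subst card_Diff_subset) auto
  then obtain z where "?C - {u, v, w} = {z}"
    by (auto simp: card_1_singleton_iff)
  then have C: "?C = {u, v, w, z}" "distinct [u, v, w, z]"
    using uC v(1) w(1) \<open>v \<noteq> u\<close> \<open>w \<noteq> u\<close> \<open>v \<noteq> w\<close> by auto
  have disj: "distinct [u, v, w, z, a, b, c]"
    using C abc by (auto simp: rim_def)
  obtain p q where pq: "N z = {p, q}" "p \<noteq> q"
    using cN[of z] C by (auto simp: card_2_iff)
  have z: "N z \<inter> {a, b} \<noteq> {}" "N z \<inter> {b, c} \<noteq> {}" "N z \<inter> {a, c} \<noteq> {}"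
    using meet[of z u] meet[of z v] meet[of z w] C ab Nv Nw by auto
  have Nz: "N z = {a, b} \<or> N z = {b, c} \<or> N z = {a, c}"
    using z pq abc(1) by auto
  have nbs: "nb u = {v, w, z, a, b}" "nb v = {u, w, z, b, c}" "nb w = {u, v, z, a, c}"
    "nb z = {u, v, w} \<union> N z"
    using nbN[of u] nbN[of v] nbN[of w] nbN[of z] C ab(1) Nv(1) Nw(1) by auto
  have inF: "u \<in> F" "v \<in> F" "w \<in> F" "z \<in> F"
    using cluster_F[OF u] C by auto
  have "\<exists>t\<in>{a, b, c}. deg t \<noteq> 4"
  proof (rule ccontr)
    assume "\<not> (\<exists>t\<in>{a, b, c}. deg t \<noteq> 4)"
    then have d: "deg a = 4" "deg b = 4" "deg c = 4"
      by auto
    from Nz show False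
    \<comment> \<open>In each case the names are permuted so that the repeated pair plays
      \<open>ab\<close> in \<open>K4_pattern\<close>; the vertex missing from it plays
      \<open>c\<close>.\<close>
    proof (elim disjE)
      assume "N z = {a, b}"
      then show False
        using K4_pattern[OF inF disj _ _ _ _ d(3)] nbs by auto
    next
      assume "N z = {b, c}"
      then show False
        using K4_pattern[of v w u z b c a] inF disj nbs d(1) by (auto simp: insert_commute)
    next
      assume "N z = {a, c}"
      then show False
        using K4_pattern[of w u v z c a b] inF disj nbs d(2) by (auto simp: insert_commute)
    qed
  qed
  then obtain t where t: "t \<in> {a, b, c}" "deg t \<noteq> 4"
    by blast
  have tV: "t \<in> V - F"
    using t abc rim_subset[of ?C] rim_F[OF u] by blast
  then have "deg t = 3"
    using deg_ge[of t] deg_le[of t] t(2) by (auto simp: F_def)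
  have "card ({a, b, c} - {t}) = 2"
    using abc(1) t(1) by (subst card_Diff_subset) auto
  moreover have "3 * card ({a, b, c} - {t}) \<le> sum wt ({a, b, c} - {t})"
    using abc by (intro sum_wt_ge[OF u]) auto
  moreover have "sum wt {a, b, c} = wt t + sum wt ({a, b, c} - {t})"
    using t(1) by (intro sum.remove) auto
  moreover have "sum wt {a, b, c} \<le> sum wt ?R"
    using abc(2) by (intro sum_mono2) auto
  ultimately show ?thesis
    using \<open>deg t = 3\<close> by (simp add: wt_def)
qed

text \<open>For sizes 2, 3, 4 the supply is at least 12, 12, 16 against a demand of 8, 12,
  16.\<close>

lemma cluster_weight:
  assumes "u \<in> F2"
  shows "4 * card (cluster u) \<le> sum wt (rim (cluster u))"
proof -
  have u: "u \<in> F" "u \<in> cluster u"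
    using assms by (simp_all add: F2_def cluster_def)
  have w: "3 * card (rim (cluster u)) \<le> sum wt (rim (cluster u))"
    using sum_wt_ge[OF u(1)] by blast
  consider "card (cluster u) = 2" | "card (cluster u) = 3" | "card (cluster u) = 4"
    using cluster_card_bounds[OF assms] by linarith
  then show ?thesis
  proof cases
    case 1
    have "card (nb u - cluster u) \<le> card (rim (cluster u))"
      using nb_minus_cluster_subset[OF u(2)] by (intro card_mono) auto
    then show ?thesis
      using card_nb_minus_cluster[OF u] w 1 by simp
  next
    case 2
    then show ?thesis
      using rim_3[OF u(1)] w by simp
  next
    case 3
    then show ?thesis
      using rim_4[OF u(1)] by simp
  qed
qed

text \<open>Vertices of \<open>F - F2\<close> are pairwise nonadjacent, so a neighbour
  \<open>t\<close> of one of them sees at most one other, by \<open>nb_outside_le_1\<close>. Double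
  counting gives \<open>5 * card (F - F2) \<le> 2 * card T\<close>, and each element of
  \<open>T\<close> weighs at least 3, which is more than enough.\<close>

lemma isolated_weight:
  defines "T \<equiv> \<Union>u\<in>F - F2. nb u"
  shows "4 * card (F - F2) \<le> sum wt T" "T \<subseteq> V - F" "u \<in> F2 \<Longrightarrow> T \<inter> rim (cluster u) = {}"
proof -
  have finT: "finite T"
    by (simp add: T_def)
  show TV: "T \<subseteq> V - F"
    using nb_subset by (auto simp: T_def F2_def)
  have two: "card {u \<in> F - F2. t \<in> nb u} \<le> 2" for t
  proof (cases "{u \<in> F - F2. t \<in> nb u} = {}")
    case False
    then obtain u where u: "u \<in> F" "u \<notin> F2" "t \<in> nb u"
      by blast
    let ?Y = "nb t - insert u (nb u)"
    have "{u \<in> F - F2. t \<in> nb u} \<subseteq> insert u ?Y"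
      using u nb_sym by (auto simp: F2_def)
    then have "card {u \<in> F - F2. t \<in> nb u} \<le> card (insert u ?Y)"
      by (intro card_mono) auto
    also have "\<dots> \<le> 2"
      using nb_outside_le_1[OF u(1,3)] by simp
    finally show ?thesis .
  next
    case True
    then show ?thesis
      unfolding True by simp
  qed
  have "5 * card (F - F2) = (\<Sum>u\<in>F - F2. card {t \<in> T. t \<in> nb u})"
  proof -
    have "card {t \<in> T. t \<in> nb u} = 5" if "u \<in> F - F2" for u
    proof -
      have "{t \<in> T. t \<in> nb u} = nb u"
        using that by (auto simp: T_def)
      then show ?thesis
        using F_D that by simp
    qed
    then show ?thesis
      by simp
  qed
  also have "\<dots> = (\<Sum>t\<in>T. card {u \<in> F - F2. t \<in> nb u})"
    using finT by (intro sum_multicount_gen) auto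
  also have "\<dots> \<le> (\<Sum>t\<in>T. 2)"
    using two by (intro sum_mono)
  finally have "5 * card (F - F2) \<le> 2 * card T"
    by simp
  moreover have "(\<Sum>t\<in>T. 3) \<le> sum wt T"
    using TV wt_ge by (intro sum_mono) blast
  ultimately show "4 * card (F - F2) \<le> sum wt T"
    by simp
  show "T \<inter> rim (cluster u) = {}" if u: "u \<in> F2"
  proof (rule ccontr)
    assume "T \<inter> rim (cluster u) \<noteq> {}"
    then obtain t x y where t: "y \<in> F - F2" "t \<in> nb y" "x \<in> cluster u" "t \<in> nb x"
      by (auto simp: T_def rim_def)
    have "cluster y = cluster x"
      using shared_same_cluster[OF cluster_F2[OF u t(3)] _ t(4,2)] t(1) by blast
    then have "y \<in> cluster x"
      by (auto simp: cluster_def)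
    then show False
      using cluster_F2[OF cluster_F2[OF u t(3)]] t(1) by blast
  qed
qed

text \<open>\<open>T1\<close> and the rims of different clusters are disjoint, so no weight is spent
  twice.\<close>

lemma total_weight: "4 * card F \<le> sum wt (V - F)"
proof -
  define T1 where "T1 = (\<Union>u\<in>F - F2. nb u)"
  define T2 where "T2 = (\<Union>C\<in>cluster ` F2. rim C)"
  have F2F: "F2 \<subseteq> F" "finite F2"
    by (auto simp: F2_def)
  have "4 * card F2 \<le> sum wt T2"
  proof -
    \<comment> \<open>Summing over the image of \<open>cluster\<close> counts each clique once and
      not once per member.\<close>
    have "F2 \<subseteq> (\<Union>C\<in>cluster ` F2. C)"
      by (auto simp: cluster_def)
    then have "card F2 \<le> card (\<Union>C\<in>cluster ` F2. C)"
      using F2F by (intro card_mono) auto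
    also have "\<dots> \<le> (\<Sum>C\<in>cluster ` F2. card C)"
      using F2F by (intro card_UN_le) auto
    finally have "4 * card F2 \<le> (\<Sum>C\<in>cluster ` F2. 4 * card C)"
      by (simp add: sum_distrib_left[symmetric])
    also have "\<dots> \<le> (\<Sum>C\<in>cluster ` F2. sum wt (rim C))"
      using cluster_weight by (intro sum_mono) auto
    also have "\<dots> = sum wt T2"
      unfolding T2_def using rim_disjoint F2F by (intro sum.UNION_disjoint[symmetric]) auto
    finally show ?thesis .
  qed
  moreover have "4 * card (F - F2) \<le> sum wt T1"
    unfolding T1_def by (rule isolated_weight)
  moreover have "card F = card F2 + card (F - F2)"
    using F2F card_Int_Diff[of F F2] by (simp add: Int_absorb1)
  moreover have "sum wt T1 + sum wt T2 \<le> sum wt (V - F)"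
  proof -
    have T1: "T1 \<subseteq> V - F"
      unfolding T1_def by (rule isolated_weight)
    have T2: "T2 \<subseteq> V - F"
      using rim_subset rim_F F2F unfolding T2_def by blast
    have "T1 \<inter> T2 = {}"
      unfolding T1_def T2_def using isolated_weight(3) by blast
    then have "sum wt T1 + sum wt T2 = sum wt (T1 \<union> T2)"
      using T1 T2 by (intro sum.union_disjoint[symmetric]) (auto intro: finite_subset)
    also have "\<dots> \<le> sum wt (V - F)"
      using T1 T2 by (intro sum_mono2) auto
    finally show ?thesis .
  qed
  ultimately show ?thesis
    by simp
qed

lemma edge_bound: "14 * card E \<le> 31 * card V"
proof -
  have FV: "F \<subseteq> V"
    by (auto simp: F_def)
  have "14 * card E = 7 * (\<Sum>v\<in>V. deg v)"
    by (simp add: handshake)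
  also have "(\<Sum>v\<in>V. deg v) = sum deg (V - F) + sum deg F"
    using FV by (intro sum.subset_diff) auto
  also have "sum deg F = 5 * card F"
    by (simp add: F_def)
  finally have "14 * card E = 7 * sum deg (V - F) + 35 * card F"
    by simp
  moreover have "7 * sum deg (V - F) + sum wt (V - F) = 31 * card (V - F)"
  proof -
    have "7 * deg v + wt v = 31" if "v \<in> V - F" for v
      using deg_le[of v] that by (auto simp: F_def wt_def)
    then have "(\<Sum>v\<in>V - F. 7 * deg v + wt v) = 31 * card (V - F)"
      by simp
    then show ?thesis
      by (simp add: sum.distrib sum_distrib_left)
  qed
  moreover have "card V = card F + card (V - F)"
    using FV card_Int_Diff[of V F] by (simp add: Int_absorb1)
  ultimately show ?thesis
    using total_weight by simp
qed

end

subsection \<open>The upper bound\<close>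

lemma planar_S24_free_bound:
  assumes "finite_simple_graph (V, E)" "free_of (V, E) (double_star 2 4)" "planar (V, E)"
  shows "14 * card E \<le> 31 * card V"
  using assms
proof (induction "card V" arbitrary: V E rule: less_induct)
  case less
  interpret simple_graph V E
    using less.prems(1) by unfold_locales
  \<comment> \<open>The induction step by deletion. It applies to a vertex of degree at most 2, as
    14 * 2 \<le> 31, and to seven vertices that meet at most 15 edges, as 14 * 15 = 210 \<le> 217 =
    31 * 7.\<close>
  have reduce: ?case if S: "S \<subseteq> V" "S \<noteq> {}" "14 * card {e \<in> E. e \<inter> S \<noteq> {}} \<le> 31 * card S" for S
  proof -
    let ?E = "{e \<in> E. e \<inter> S = {}}"
    have "card (V - S) < card V"
      using S(1,2) by (intro psubset_card_mono) auto
    moreover have "free_of (V - S, ?E) (double_star 2 4)"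
      using less.prems(2) contains_copy_mono[of "V - S" ?E _ V E] unfolding free_of_def by blast
    moreover have "planar (V - S, ?E)"
      by (rule planar_subgraph[OF less.prems(3)]) (use edge in auto)
    ultimately have "14 * card ?E \<le> 31 * card (V - S)"
      using less.hyps finite_simple_delete by blast
    moreover have "card V = card (V - S) + card S"
      using S(1) card_Int_Diff[of V S] by (simp add: Int_absorb1)
    ultimately show ?thesis
      using card_edges_split[of S] S(3) by simp
  qed
  show ?case
  proof (cases "\<exists>v\<in>V. deg v \<le> 2")
    case True
    then obtain v where v: "v \<in> V" "deg v \<le> 2"
      by blast
    then show ?thesis
      using card_incident[of v] by (intro reduce[of "{v}"]) simp_all
  next
    case False
    then have ge: "3 \<le> deg v" if "v \<in> V" for v
      using that by force
    have union: "card (nb u \<union> nb v) \<le> 7" if uv: "v \<in> nb u" and u: "5 \<le> deg u" for u v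
    proof (rule ccontr)
      assume "\<not> card (nb u \<union> nb v) \<le> 7"
      then have "contains_copy (V, E) (double_star 2 4)"
        using uv u ge nb_in_V by (intro double_star_copy[of v u]) auto
      then show False
        using less.prems(2) by (simp add: free_of_def)
    qed
    show ?thesis
    proof (cases "\<exists>u\<in>V. 6 \<le> deg u")
      case True
      then obtain u where u: "u \<in> V" "6 \<le> deg u"
        by blast
      let ?S = "insert u (nb u)"
      have sub: "?S \<subseteq> nb u \<union> nb v" if "v \<in> nb u" for v
        using that nb_sym[of u v] by blast
      have "nb u \<noteq> {}"
        using u by (auto simp: deg_def)
      then obtain v where v: "v \<in> nb u"
        by blast
      have "card ?S \<le> 7"
        using card_mono[OF _ sub[OF v]] union[OF v] u by simp
      then have S: "card ?S = 7"
        using u by (simp add: deg_def)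
      \<comment> \<open>The closed neighbourhood of \<open>u\<close> has 7 elements and lies in a
        union of at most 7, hence equals it. As this holds for every neighbour \<open>v\<close>, no
        edge leaves the set.\<close>
      have closed: "nb v \<subseteq> ?S" if "v \<in> nb u" for v
      proof -
        have "?S = nb u \<union> nb v"
          using sub[OF that] union[OF that] S u by (intro card_seteq) auto
        then show ?thesis
          by blast
      qed
      let ?F = "{e \<in> E. e \<inter> ?S \<noteq> {}}"
      have F: "e \<subseteq> ?S" if e: "e \<in> ?F" for e
      proof -
        obtain x y where xy: "e = {x, y}" "y \<in> nb x"
          using edge_cases[of e] e by blast
        then have "x \<in> ?S \<or> y \<in> ?S"
          using e by blast
        then show ?thesis
          using closed[of x] closed[of y] xy nb_sym[of x y] by blast
      qed
      have SV: "?S \<subseteq> V"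
        using u nb_subset by blast
      have "card ?F \<le> 15"
      proof (rule dominated_7[of ?S ?F u])
        show "finite_simple_graph (?S, ?F)"
          using F edge by (auto simp: finite_simple_graph_def)
        show "planar (?S, ?F)"
          by (rule planar_subgraph[OF less.prems(3) SV]) (use F in auto)
        show "{u, v} \<in> ?F" if "v \<in> ?S - {u}" for v
          using that by (simp add: nb_iff)
      qed (use S in auto)
      then show ?thesis
        using S SV by (intro reduce[of ?S]) auto
    next
      case False
      interpret star_free_graph V E
      proof
        show "deg v \<le> 5" if "v \<in> V" for v
          using False that by force
        show "False" if "card A = 3" "card B = 3" "A \<inter> B = {}" "\<And>a b. a \<in> A \<Longrightarrow> b \<in> B \<Longrightarrow> b \<in> nb a" for A B
          using planar_no_K33[OF less.prems(1,3) that(1-3)] that(4) by (auto simp: nb_iff)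
        show "False" if "card K = 5" "\<And>x y. x \<in> K \<Longrightarrow> y \<in> K \<Longrightarrow> x \<noteq> y \<Longrightarrow> y \<in> nb x" for K
          using planar_no_K5[OF less.prems(1,3) that(1)] that(2) by (auto simp: nb_iff)
      qed (use ge union in auto)
      show ?thesis
        by (rule edge_bound)
    qed
  qed
qed

subsection \<open>The extremal graphs\<close>

text \<open>Each of the eight vertices of a double star, the centres included, is adjacent to one of
  the two centres; \<open>f 1\<close> is the centre with four leaves.\<close>

lemma (in simple_graph) copy_imp_large_union:
  assumes "contains_copy (V, E) (double_star 2 4)"
  obtains u v where "v \<in> nb u" "5 \<le> deg u" "8 \<le> card (nb u \<union> nb v)"
proof -
  have ds: "double_star 2 4 = ({..<8::nat}, {{0, 1}} \<union> {{0, i} | i. i \<in> {2..<4}} \<union> {{1, i} | i. i \<in> {4..<8}})"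
    by (simp add: double_star_def)
  obtain f where f: "inj_on f {..<8::nat}"
    and fE: "\<And>e. e \<in> {{0, 1}} \<union> {{0, i} | i. i \<in> {2..<4}} \<union> {{1, i} | i. i \<in> {4..<8}} \<Longrightarrow> f ` e \<in> E"
    using assms unfolding contains_copy_def ds fst_conv snd_conv by blast
  have v: "f i \<in> nb (f 0)" if "i \<in> {1, 2, 3}" for i
  proof -
    have "f ` {0, i} \<in> E"
      by (rule fE) (use that in auto)
    then show ?thesis
      by (simp add: nb_def)
  qed
  have u: "f i \<in> nb (f 1)" if "i \<in> {0, 4, 5, 6, 7}" for i
  proof -
    have "f ` {1, i} \<in> E"
      by (rule fE) (use that in \<open>auto simp: insert_commute\<close>)
    then show ?thesis
      by (simp add: nb_def)
  qed
  have "card (f ` {0, 4, 5, 6, 7}) = 5"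
  proof -
    have "inj_on f {0, 4, 5, 6, 7}"
      using f by (rule inj_on_subset) auto
    then show ?thesis
      by (simp add: card_image)
  qed
  then have "5 \<le> deg (f 1)"
    unfolding deg_def using u card_mono[of "nb (f 1)" "f ` {0, 4, 5, 6, 7}"] by auto
  moreover have "8 \<le> card (nb (f 1) \<union> nb (f 0))"
  proof -
    have "i \<in> {1, 2, 3} \<or> i \<in> {0, 4, 5, 6, 7}" if "i < 8" for i :: nat
      using that by auto
    then have "f ` {..<8} \<subseteq> nb (f 1) \<union> nb (f 0)"
      using u v by blast
    then have "card (f ` {..<8}) \<le> card (nb (f 1) \<union> nb (f 0))"
      by (intro card_mono) auto
    then show ?thesis
      by (simp add: card_image[OF f])
  qed
  ultimately show ?thesis
    using that[of "f 0" "f 1"] u[of 0] by simp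
qed

section \<open>Line segments separated by linear functionals\<close>

lemma closed_segment_disjoint:
  fixes f :: "complex \<Rightarrow> real"
  assumes "linear f" "f P < c" "f Q < c" "c \<le> f R" "c \<le> f S"
  shows "closed_segment P Q \<inter> closed_segment R S = {}"
proof -
  have "convex (f -` {..<c})" "convex (f -` {c..})"
    using convex_linear_vimage[OF assms(1)] by auto
  then have "closed_segment P Q \<subseteq> f -` {..<c}" "closed_segment R S \<subseteq> f -` {c..}"
    using assms by (intro closed_segment_subset; simp)+
  then show ?thesis
    by fastforce
qed

text \<open>Along \<open>P Q\<close> the functional drops strictly below \<open>c\<close> as soon as
  \<open>P\<close> is left, while it stays at or above \<open>c\<close> along
  \<open>P S\<close>.\<close>

lemma closed_segment_meet:
  fixes f :: "complex \<Rightarrow> real"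
  assumes f: "linear f" and "f P = c" "f Q < c" "c \<le> f S"
  shows "closed_segment P Q \<inter> closed_segment P S = {P}"
proof -
  have "convex (f -` {c..})"
    using convex_linear_vimage[OF f] by auto
  then have S: "closed_segment P S \<subseteq> f -` {c..}"
    using assms by (intro closed_segment_subset) simp_all
  have "z = P" if z: "z \<in> closed_segment P Q" "c \<le> f z" for z
  proof -
    obtain t where t: "0 \<le> t" "z = (1 - t) *\<^sub>R P + t *\<^sub>R Q"
      using z(1) by (auto simp: closed_segment_def)
    have "f z = (1 - t) * f P + t * f Q"
      unfolding t(2) by (simp add: linear_add[OF f] linear_scale[OF f])
    then have "f z = c + t * (f Q - c)"
      using assms(2) by (simp add: algebra_simps)
    then have "0 \<le> t * (f Q - c)"
      using z(2) by simp
    then have "t = 0"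
      using assms(3) t(1) by (simp add: zero_le_mult_iff)
    then show ?thesis
      using t(2) by simp
  qed
  then show ?thesis
    using S by auto
qed

text \<open>Twice the signed area of the triangle \<open>A B C\<close>; its sign tells on which side
  of the line \<open>A B\<close> the point \<open>C\<close> lies.\<close>

definition orient :: "complex \<Rightarrow> complex \<Rightarrow> complex \<Rightarrow> real" where
  "orient A B C = (Re B - Re A) * (Im C - Im A) - (Im B - Im A) * (Re C - Re A)"

lemma linear_form: "linear (\<lambda>z. a * Im z + b * Re z)"
  by (intro linearI) (simp_all add: algebra_simps)

lemma closed_segment_disjoint_orient:
  assumes "0 < orient A B C * orient A B D"
  shows "closed_segment A B \<inter> closed_segment C D = {}"
proof -
  \<comment> \<open>Constant along the line \<open>A B\<close>, this functional changes at
    \<open>C\<close> by \<open>s * orient A B C\<close>; choosing \<open>s\<close> as 1 or -1 puts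
    \<open>C\<close> on the negative side.\<close>
  let ?f = "\<lambda>s z. s * (Re B - Re A) * Im z + (- s * (Im B - Im A)) * Re z"
  have f: "?f s A = ?f s B" "?f s C = ?f s A + s * orient A B C" "?f s D = ?f s A + s * orient A B D" for s
    by (simp_all add: orient_def algebra_simps)
  have *: "closed_segment C D \<inter> closed_segment A B = {}"
    if "s * orient A B C < 0" "s * orient A B D < 0" for s
    using f[of s] that
    by (intro closed_segment_disjoint[where f = "?f s" and c = "?f s A"] linear_form) linarith+
  from assms consider "orient A B C < 0" "orient A B D < 0" | "0 < orient A B C" "0 < orient A B D"
    by (auto simp: zero_less_mult_iff)
  then show ?thesis
    using *[of 1] *[of "- 1"] by cases auto
qed

lemma closed_segment_meet_orient:
  assumes "orient A B C \<noteq> 0"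
  shows "closed_segment A B \<inter> closed_segment A C = {A}"
proof -
  let ?f = "\<lambda>s z. s * (Re B - Re A) * Im z + (- s * (Im B - Im A)) * Re z"
  have f: "?f s A = ?f s B" "?f s C = ?f s A + s * orient A B C" for s
    by (simp_all add: orient_def algebra_simps)
  have *: "closed_segment A C \<inter> closed_segment A B = {A}" if "s * orient A B C < 0" for s
    using f[of s] that
    by (intro closed_segment_meet[where f = "?f s" and c = "?f s A"] linear_form refl) linarith+
  show ?thesis
    using assms *[of 1] *[of "- 1"] by (cases "orient A B C < 0") auto
qed

text \<open>One block of the extremal graph: an octahedron on \<open>1, \<dots>, 6\<close> (antipodal pairs
  \<open>14\<close>, \<open>25\<close>, \<open>36\<close>) with the vertex \<open>0\<close> joined to its face \<open>123\<close>.\<close>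

definition block_edges :: "(nat \<times> nat) list" where
  "block_edges = [(0,1), (0,2), (0,3), (1,2), (1,3), (2,3), (4,5), (4,6), (5,6),
    (1,5), (1,6), (2,4), (2,6), (3,4), (3,5)]"

text \<open>A straight-line drawing: 0, 1, 2 form the outer triangle, 3 lies inside it, and 4, 5, 6
  lie inside the triangle 1 2 3. Vertex 0 is the strict maximum in height, which keeps it accessible
  for a bridge. Integer coordinates make crossings decidable by evaluation.\<close>

definition block_x :: "nat \<Rightarrow> int" where
  "block_x r = [0, - 10, 10, 0, 2, - 2, 0] ! r"

definition block_y :: "nat \<Rightarrow> int" where
  "block_y r = [20, 0, 0, 10, 5, 5, 1] ! r"

definition block_orient :: "nat \<Rightarrow> nat \<Rightarrow> nat \<Rightarrow> int" where
  "block_orient i j k = (block_x j - block_x i) * (block_y k - block_y i)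
     - (block_y j - block_y i) * (block_x k - block_x i)"

text \<open>A sufficient test. Edges with a common end must not be collinear; otherwise the line
  through one edge must have both ends of the other strictly on one side.\<close>

definition non_crossing :: "nat \<times> nat \<Rightarrow> nat \<times> nat \<Rightarrow> bool" where
  "non_crossing e e' = (case (e, e') of ((i, j), (k, l)) \<Rightarrow>
     (if i = k then block_orient i j l \<noteq> 0
      else if j = l then block_orient j i k \<noteq> 0
      else if i = l then block_orient i j k \<noteq> 0
      else if j = k then block_orient j i l \<noteq> 0
      else 0 < block_orient i j k * block_orient i j l \<or> 0 < block_orient k l i * block_orient k l j))"

lemma block_non_crossing:
  "\<forall>e \<in> set block_edges. \<forall>e' \<in> set block_edges. e \<noteq> e' \<longrightarrow> non_crossing e e'"
  by code_simp

lemma block_edges_less: "(i, j) \<in> set block_edges \<Longrightarrow> i < j \<and> j < 7"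
  by (auto simp: block_edges_def)

definition block_nb :: "nat \<Rightarrow> nat set" where
  "block_nb r = {s. (r, s) \<in> set block_edges \<or> (s, r) \<in> set block_edges}"

lemma block_nb_simps:
  "block_nb 0 = {1, 2, 3}" "block_nb 1 = {0, 2, 3, 5, 6}" "block_nb 2 = {0, 1, 3, 4, 6}"
  "block_nb 3 = {0, 1, 2, 4, 5}" "block_nb 4 = {2, 3, 5, 6}" "block_nb 5 = {1, 3, 4, 6}"
  "block_nb 6 = {1, 2, 4, 5}"
  by (auto simp: block_nb_def block_edges_def)

text \<open>Vertex \<open>7 * q + r\<close> is vertex \<open>r\<close> of block \<open>q\<close>. A
  block has width 20, so the shift by 30 puts the blocks into disjoint vertical strips.\<close>

definition pos :: "nat \<Rightarrow> complex" where
  "pos u = Complex (30 * real (u div 7) + of_int (block_x (u mod 7))) (of_int (block_y (u mod 7)))"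

lemma pos_block: "r < 7 \<Longrightarrow> pos (7 * q + r) = Complex (30 * real q + of_int (block_x r)) (of_int (block_y r))"
  by (simp add: pos_def)

lemma orient_block:
  "i < 7 \<Longrightarrow> j < 7 \<Longrightarrow> k < 7 \<Longrightarrow>
    orient (pos (7 * q + i)) (pos (7 * q + j)) (pos (7 * q + k)) = of_int (block_orient i j k)"
  by (simp add: pos_block orient_def block_orient_def)

definition seg :: "nat \<Rightarrow> nat \<Rightarrow> complex set" where
  "seg u v = closed_segment (pos u) (pos v)"

lemma seg_commute: "seg u v = seg v u"
  by (simp add: seg_def closed_segment_commute)

lemma seg_same_block:
  assumes "(i, j) \<in> set block_edges" "(k, l) \<in> set block_edges" "(i, j) \<noteq> (k, l)"
  shows "seg (7 * q + i) (7 * q + j) \<inter> seg (7 * q + k) (7 * q + l)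
     = pos ` ({7 * q + i, 7 * q + j} \<inter> {7 * q + k, 7 * q + l})"
proof -
  have less: "i < j" "i < 7" "j < 7" "k < l" "k < 7" "l < 7"
    using block_edges_less assms by fastforce+
  have meet: "seg (7 * q + a) (7 * q + b) \<inter> seg (7 * q + a) (7 * q + d) = {pos (7 * q + a)}"
    if "block_orient a b d \<noteq> 0" "a < 7" "b < 7" "d < 7" for a b d
    unfolding seg_def using that by (intro closed_segment_meet_orient) (simp add: orient_block)
  have disj: "seg (7 * q + a) (7 * q + b) \<inter> seg (7 * q + d) (7 * q + e) = {}"
    if "0 < block_orient a b d * block_orient a b e" "a < 7" "b < 7" "d < 7" "e < 7" for a b d e
    unfolding seg_def using that
    by (intro closed_segment_disjoint_orient) (simp add: orient_block flip: of_int_mult)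
  have nc: "non_crossing (i, j) (k, l)"
    using block_non_crossing assms by blast
  consider "i = k" "j \<noteq> l" | "i \<noteq> k" "j = l" | "i = l" "i \<noteq> k" "j \<noteq> l" | "j = k" "i \<noteq> k" "j \<noteq> l" "i \<noteq> l"
    | "i \<noteq> k" "j \<noteq> l" "i \<noteq> l" "j \<noteq> k"
    using assms(3) by auto
  then show ?thesis
  proof cases
    case 1
    have "{7 * q + i, 7 * q + j} \<inter> {7 * q + k, 7 * q + l} = {7 * q + i}"
      using 1 less by auto
    then show ?thesis
      using nc 1 less meet[of i j l] by (simp add: non_crossing_def)
  next
    case 2
    have "{7 * q + i, 7 * q + j} \<inter> {7 * q + k, 7 * q + l} = {7 * q + j}"
      using 2 less by auto
    then show ?thesis
      using nc 2 less meet[of j i k] by (simp add: non_crossing_def seg_commute)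
  next
    case 3
    have "{7 * q + i, 7 * q + j} \<inter> {7 * q + k, 7 * q + l} = {7 * q + i}"
      using 3 less by auto
    then show ?thesis
      using nc 3 less meet[of i j k] by (simp add: non_crossing_def seg_commute[of "7 * q + k"])
  next
    case 4
    have "{7 * q + i, 7 * q + j} \<inter> {7 * q + k, 7 * q + l} = {7 * q + j}"
      using 4 less by auto
    then show ?thesis
      using nc 4 less meet[of j i l] by (simp add: non_crossing_def seg_commute[of "7 * q + i"])
  next
    case 5
    have "{7 * q + i, 7 * q + j} \<inter> {7 * q + k, 7 * q + l} = {}"
      using 5 less by auto
    moreover have "seg (7 * q + i) (7 * q + j) \<inter> seg (7 * q + k) (7 * q + l) = {}"
      using nc 5 less disj[of i j k l] disj[of k l i j] by (auto simp: non_crossing_def)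
    ultimately show ?thesis
      by simp
  qed
qed

section \<open>Blocks and bridges do not cross\<close>

lemma block_coords:
  assumes "r < 7"
  shows "\<bar>block_x r\<bar> \<le> 10" "r \<noteq> 0 \<Longrightarrow> block_y r < 20" "block_x 0 = 0" "block_y 0 = 20"
proof -
  have "r \<in> {0, 1, 2, 3, 4, 5, 6}"
    using assms by auto
  then show "\<bar>block_x r\<bar> \<le> 10" "r \<noteq> 0 \<Longrightarrow> block_y r < 20" "block_x 0 = 0" "block_y 0 = 20"
    by (auto simp: block_x_def block_y_def)
qed

lemma Re_pos: "30 * real (u div 7) - 10 \<le> Re (pos u)" "Re (pos u) \<le> 30 * real (u div 7) + 10"
  using block_coords(1)[of "u mod 7"] by (simp_all add: pos_def abs_le_iff)

lemma Im_pos: "u mod 7 \<noteq> 0 \<Longrightarrow> Im (pos u) < 20" "u mod 7 = 0 \<Longrightarrow> Im (pos u) = 20"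
  "u mod 7 = 0 \<Longrightarrow> Re (pos u) = 30 * real (u div 7)"
  using block_coords[of "u mod 7"] by (simp_all add: pos_def)

lemma linear_Re: "linear Re" and linear_Im: "linear Im"
  by (simp_all add: linearI)

lemma seg_disjoint_Re:
  assumes "Re (pos u) < c" "Re (pos v) < c" "c \<le> Re (pos u')" "c \<le> Re (pos v')"
  shows "seg u v \<inter> seg u' v' = {}"
  unfolding seg_def using linear_Re assms by (rule closed_segment_disjoint)

text \<open>The smaller end comes first, so every edge is listed once. A bridge joins the vertices 0
  of the blocks \<open>2 * k\<close> and \<open>2 * k + 1\<close>.\<close>

inductive_set oriented_edges :: "nat \<Rightarrow> (nat \<times> nat) set" for m where
  block: "q < 2 * m \<Longrightarrow> (i, j) \<in> set block_edges \<Longrightarrow> (7 * q + i, 7 * q + j) \<in> oriented_edges m"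
| bridge: "k < m \<Longrightarrow> (14 * k, 14 * k + 7) \<in> oriented_edges m"

text \<open>Bridges are horizontal at height 20, which a block attains only at its vertex 0. Blocks
  other than the two it joins are avoided by the bridge because of their strips.\<close>

lemma seg_block_bridge:
  assumes "(i, j) \<in> set block_edges"
  shows "seg (7 * q + i) (7 * q + j) \<inter> seg (14 * k) (14 * k + 7)
    = pos ` ({7 * q + i, 7 * q + j} \<inter> {14 * k, 14 * k + 7})"
proof -
  have ij: "i < j" "j < 7"
    using block_edges_less assms by auto
  have div: "14 * k div 7 = 2 * k" "(14 * k + 7) div 7 = 2 * k + 1" "14 * k mod 7 = 0" "(14 * k + 7) mod 7 = 0"
    by presburger+
  let ?u = "7 * q + i" and ?v = "7 * q + j"
  have uv: "?u div 7 = q" "?v div 7 = q" "?u mod 7 = i" "?v mod 7 = j"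
    using ij by simp_all
  have b: "Re (pos (14 * k)) = 60 * real k" "Re (pos (14 * k + 7)) = 60 * real k + 30"
     "Im (pos (14 * k)) = 20" "Im (pos (14 * k + 7)) = 20"
    using Im_pos[of "14 * k"] Im_pos[of "14 * k + 7"] by (simp_all add: div)
  have R: "30 * real q - 10 \<le> Re (pos ?u)" "Re (pos ?u) \<le> 30 * real q + 10"
    "30 * real q - 10 \<le> Re (pos ?v)" "Re (pos ?v) \<le> 30 * real q + 10"
    using Re_pos[of ?u] Re_pos[of ?v] unfolding uv by simp_all
  have v: "Im (pos ?v) < 20"
    using Im_pos(1)[of ?v] uv ij by simp
  consider "q < 2 * k" | "2 * k + 1 < q" | "q = 2 * k" "i = 0" | "q = 2 * k + 1" "i = 0"
    | "q = 2 * k \<or> q = 2 * k + 1" "i \<noteq> 0"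
    by linarith
  then show ?thesis
  proof cases
    case 1
    then have "real q + 1 \<le> 2 * real k"
      by linarith
    then have "seg ?u ?v \<inter> seg (14 * k) (14 * k + 7) = {}"
      using R b by (intro seg_disjoint_Re[of _ "60 * real k"]) linarith+
    moreover have "{?u, ?v} \<inter> {14 * k, 14 * k + 7} = {}"
      using 1 ij by auto
    ultimately show ?thesis
      by simp
  next
    case 2
    then have "2 * real k + 2 \<le> real q"
      by linarith
    \<comment> \<open>The separating abscissa is the left border of block \<open>2 * k + 2\<close>,
      at 30 * (2 * k + 2) - 10.\<close>
    then have "seg (14 * k) (14 * k + 7) \<inter> seg ?u ?v = {}"
      using R b by (intro seg_disjoint_Re[of _ "60 * real k + 50"]) linarith+
    moreover have "{?u, ?v} \<inter> {14 * k, 14 * k + 7} = {}"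
      using 2 ij by auto
    ultimately show ?thesis
      by (simp add: Int_commute)
  next
    case 3
    have "seg ?u ?v \<inter> seg (14 * k) (14 * k + 7) = {pos (14 * k)}"
      unfolding seg_def using 3 closed_segment_meet[OF linear_Im, of "pos (14 * k)" 20 "pos ?v" "pos (14 * k + 7)"] v b
      by simp
    moreover have "{?u, ?v} \<inter> {14 * k, 14 * k + 7} = {14 * k}"
      using 3 ij by auto
    ultimately show ?thesis
      by simp
  next
    case 4
    have "seg ?u ?v \<inter> seg (14 * k + 7) (14 * k) = {pos (14 * k + 7)}"
      unfolding seg_def using 4 closed_segment_meet[OF linear_Im, of "pos (14 * k + 7)" 20 "pos ?v" "pos (14 * k)"] v b
      by (simp add: algebra_simps)
    moreover have "{?u, ?v} \<inter> {14 * k, 14 * k + 7} = {14 * k + 7}"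
      using 4 ij by auto
    ultimately show ?thesis
      by (simp add: seg_commute)
  next
    case 5
    have "Im (pos ?u) < 20"
      using Im_pos(1)[of ?u] uv 5 by simp
    then have "seg ?u ?v \<inter> seg (14 * k) (14 * k + 7) = {}"
      unfolding seg_def using v b by (intro closed_segment_disjoint[OF linear_Im, of _ 20]) simp_all
    moreover have "?u \<noteq> 14 * k" "?u \<noteq> 14 * k + 7" "?v \<noteq> 14 * k" "?v \<noteq> 14 * k + 7"
      using 5 ij by presburger+
    then have "{?u, ?v} \<inter> {14 * k, 14 * k + 7} = {}"
      by simp
    ultimately show ?thesis
      by simp
  qed
qed

lemma seg_oriented_edges:
  assumes "(u, v) \<in> oriented_edges m" "(u', v') \<in> oriented_edges m" "(u, v) \<noteq> (u', v')"
  shows "seg u v \<inter> seg u' v' = pos ` ({u, v} \<inter> {u', v'})"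
  using assms(1)
proof cases
  case e: (block q i j)
  have ij: "i < 7" "j < 7"
    using block_edges_less e by fastforce+
  from assms(2) show ?thesis
  proof cases
    case e': (block q' k l)
    have kl: "k < 7" "l < 7"
      using block_edges_less e' by fastforce+
    have div: "u div 7 = q" "v div 7 = q" "u' div 7 = q'" "v' div 7 = q'"
      using e e' ij kl by simp_all
    show ?thesis
    proof (cases "q = q'")
      case True
      then show ?thesis
        using seg_same_block[of i j k l q] e e' assms(3) by simp
    next
      case False
      then have "{u, v} \<inter> {u', v'} = {}"
        using div by auto
      moreover have "seg u v \<inter> seg u' v' = {}"
      proof (cases "q < q'")
        case True
        then have "real q + 1 \<le> real q'"
          by linarith
        then show ?thesis
          using Re_pos[of u] Re_pos[of v] Re_pos[of u'] Re_pos[of v'] unfolding div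
          by (intro seg_disjoint_Re[of _ "30 * real q' - 10"]) linarith+
      next
        case False
        then have "real q' + 1 \<le> real q"
          using \<open>q \<noteq> q'\<close> by linarith
        then have "seg u' v' \<inter> seg u v = {}"
          using Re_pos[of u] Re_pos[of v] Re_pos[of u'] Re_pos[of v'] unfolding div
          by (intro seg_disjoint_Re[of _ "30 * real q - 10"]) linarith+
        then show ?thesis
          by (simp add: Int_commute)
      qed
      ultimately show ?thesis
        by simp
    qed
  next
    case (bridge k)
    then show ?thesis
      using seg_block_bridge e by simp
  qed
next
  case e: (bridge k)
  from assms(2) show ?thesis
  proof cases
    case (block q i j)
    then show ?thesis
      using seg_block_bridge[of i j q k] e by (simp add: Int_commute)
  next
    case e': (bridge k')
    have b: "Re (pos (14 * h)) = 60 * real h" "Re (pos (14 * h + 7)) = 60 * real h + 30" for h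
    proof -
      have div: "14 * h div 7 = 2 * h" "(14 * h + 7) div 7 = 2 * h + 1" "14 * h mod 7 = 0" "(14 * h + 7) mod 7 = 0"
        by presburger+
      show "Re (pos (14 * h)) = 60 * real h" "Re (pos (14 * h + 7)) = 60 * real h + 30"
        using Im_pos(3)[of "14 * h"] Im_pos(3)[of "14 * h + 7"] by (simp_all add: div)
    qed
    have "k \<noteq> k'"
      using assms(3) e e' by auto
    then have "{u, v} \<inter> {u', v'} = {}"
      using e e' by auto
    moreover have "seg u v \<inter> seg u' v' = {}"
    proof (cases "k < k'")
      case True
      then have "real k + 1 \<le> real k'"
        by linarith
      then show ?thesis
        unfolding e e' using b[of k] b[of k'] by (intro seg_disjoint_Re[of _ "60 * real k'"]) linarith+
    next
      case False
      then have "real k' + 1 \<le> real k"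
        using \<open>k \<noteq> k'\<close> by linarith
      then have "seg u' v' \<inter> seg u v = {}"
        unfolding e e' using b[of k] b[of k'] by (intro seg_disjoint_Re[of _ "60 * real k"]) linarith+
      then show ?thesis
        by (simp add: Int_commute)
    qed
    ultimately show ?thesis
      by simp
  qed
qed

lemma block_inj:
  "\<forall>r \<in> {..<7}. \<forall>s \<in> {..<7}. block_x r = block_x s \<and> block_y r = block_y s \<longrightarrow> r = s"
  by code_simp

lemma block_nb_less: "block_nb r \<subseteq> {..<7}"
  by (auto simp: block_nb_def dest: block_edges_less)

lemma inj_pos: "inj pos"
proof (rule injI)
  fix u v assume eq: "pos u = pos v"
  then have "\<bar>30 * real (u div 7) - 30 * real (v div 7)\<bar> \<le> 20"
    using Re_pos[of u] Re_pos[of v] arg_cong[OF eq, of Re] unfolding abs_le_iff by linarith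
  then have div: "u div 7 = v div 7"
    by linarith
  have "u mod 7 \<in> {..<7}" "v mod 7 \<in> {..<7}"
    by simp_all
  moreover have "block_x (u mod 7) = block_x (v mod 7)" "block_y (u mod 7) = block_y (v mod 7)"
    using eq div by (simp_all add: pos_def)
  ultimately have "u mod 7 = v mod 7"
    using block_inj by blast
  then show "u = v"
    using div by (metis div_mult_mod_eq)
qed

lemma oriented_edges_less: "(u, v) \<in> oriented_edges m \<Longrightarrow> u < v \<and> v < 14 * m"
proof (induction u v rule: oriented_edges.induct)
  case (block q i j)
  then show ?case
    using block_edges_less[of i j] by auto
qed auto

section \<open>Edge count, planarity and freeness of the extremal graphs\<close>

definition extremal_edges :: "nat \<Rightarrow> nat set set" where
  "extremal_edges m = (\<lambda>(u, v). {u, v}) ` oriented_edges m"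

lemma extremal_edges_iff: "{u, v} \<in> extremal_edges m \<longleftrightarrow> (u, v) \<in> oriented_edges m \<or> (v, u) \<in> oriented_edges m"
  by (force simp: extremal_edges_def doubleton_eq_iff)

lemma extremal_edgesE:
  assumes "e \<in> extremal_edges m"
  obtains u v where "e = {u, v}" "(u, v) \<in> oriented_edges m"
  using assms by (auto simp: extremal_edges_def)

lemma finite_simple_extremal: "finite_simple_graph ({..<14 * m}, extremal_edges m)"
proof -
  have "e \<subseteq> {..<14 * m} \<and> card e = 2" if "e \<in> extremal_edges m" for e
  proof -
    obtain u v where "e = {u, v}" "(u, v) \<in> oriented_edges m"
      using \<open>e \<in> extremal_edges m\<close> by (rule extremal_edgesE)
    then show ?thesis
      using oriented_edges_less[of u v m] by auto
  qed
  then show ?thesis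
    by (simp add: finite_simple_graph_def)
qed

lemma oriented_edges_eq: "oriented_edges m = (\<lambda>(q, i, j). (7 * q + i, 7 * q + j)) ` ({..<2 * m} \<times> set block_edges)
    \<union> (\<lambda>k. (14 * k, 14 * k + 7)) ` {..<m}" (is "_ = ?B \<union> ?C")
proof
  have "(u, v) \<in> ?B \<union> ?C" if "(u, v) \<in> oriented_edges m" for u v
    using that
  proof cases
    case (block q i j)
    then have "(q, i, j) \<in> {..<2 * m} \<times> set block_edges" "(u, v) = (\<lambda>(q, i, j). (7 * q + i, 7 * q + j)) (q, i, j)"
      by simp_all
    then show ?thesis
      by blast
  next
    case (bridge k)
    then show ?thesis
      by blast
  qed
  then show "oriented_edges m \<subseteq> ?B \<union> ?C"
    by (rule subrelI)
  show "?B \<union> ?C \<subseteq> oriented_edges m"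
    by (auto intro: oriented_edges.intros)
qed

text \<open>There are \<open>2 * m\<close> blocks of 15 edges and \<open>m\<close> bridges.\<close>

lemma card_extremal_edges: "card (extremal_edges m) = 31 * m"
proof -
  let ?f = "\<lambda>(q, i, j). (7 * q + i, 7 * q + j :: nat)" and ?A = "{..<2 * m} \<times> set block_edges"
  have "inj_on (\<lambda>(u, v). {u, v}) (oriented_edges m)"
  proof (rule inj_onI, clarify)
    fix u v u' v' assume "(u, v) \<in> oriented_edges m" "(u', v') \<in> oriented_edges m" "{u, v} = {u', v'}"
    then show "u = u' \<and> v = v'"
      using oriented_edges_less[of u v m] oriented_edges_less[of u' v' m] by (auto simp: doubleton_eq_iff)
  qed
  then have "card (extremal_edges m) = card (oriented_edges m)"
    unfolding extremal_edges_def by (rule card_image)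
  also have "\<dots> = card (?f ` ?A) + card ((\<lambda>k. (14 * k, 14 * k + 7)) ` {..<m})"
    unfolding oriented_edges_eq
  proof (rule card_Un_disjoint)
    have ne: "14 * k + 7 \<noteq> 7 * q + j \<or> 14 * k \<noteq> 7 * q + i" if "(i, j) \<in> set block_edges" for i j k q :: nat
      using block_edges_less[OF that] by presburger
    have "?f x \<noteq> (14 * k, 14 * k + 7)" if x: "x \<in> ?A" for x k
    proof -
      obtain q i j where "x = (q, i, j)" "(i, j) \<in> set block_edges"
        using x by auto
      then show ?thesis
        using ne[of i j k q] by auto
    qed
    then show "?f ` ?A \<inter> (\<lambda>k. (14 * k, 14 * k + 7)) ` {..<m} = {}"
      by blast
  qed auto
  also have "card (?f ` ?A) = card ?A"
  proof (rule card_image, rule inj_onI)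
    fix x x' assume x: "x \<in> ?A" "x' \<in> ?A" "?f x = ?f x'"
    obtain q i j q' i' j' where xs: "x = (q, i, j)" "x' = (q', i', j')"
      using prod_cases3 by metis
    then have ij: "(i, j) \<in> set block_edges" "(i', j') \<in> set block_edges"
      and eq: "7 * q + i = 7 * q' + i'" "7 * q + j = 7 * q' + j'"
      using x by auto
    have "i < 7" "i' < 7"
      using block_edges_less[OF ij(1)] block_edges_less[OF ij(2)] by simp_all
    then have "q = q'"
      using eq(1) by presburger
    then show "x = x'"
      using eq xs by simp
  qed
  also have "card ?A = 30 * m"
    by (simp add: card_cartesian_product block_edges_def)
  also have "card ((\<lambda>k. (14 * k, 14 * k + 7)) ` {..<m}) = m"
    by (subst card_image) (auto simp: inj_on_def)
  finally show ?thesis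
    by simp
qed

lemma planar_extremal: "planar ({..<14 * m}, extremal_edges m)"
proof -
  \<comment> \<open>An edge is an unordered pair; minimum and maximum recover the orientation used
    in \<open>oriented_edges\<close>.\<close>
  define c where "c e = linepath (pos (Min e)) (pos (Max e))" for e
  have c: "c {u, v} = linepath (pos u) (pos v)" "path_image (c {u, v}) = seg u v" if "(u, v) \<in> oriented_edges m" for u v
    using oriented_edges_less[OF that] by (simp_all add: c_def seg_def min_def max_def)
  have seg: "path_image (c e) \<inter> path_image (c e') = pos ` (e \<inter> e')"
    if ee: "e \<in> extremal_edges m" "e' \<in> extremal_edges m" "e \<noteq> e'" for e e'
  proof -
    obtain u v where uv: "e = {u, v}" "(u, v) \<in> oriented_edges m"
      using ee(1) by (rule extremal_edgesE)
    obtain u' v' where uv': "e' = {u', v'}" "(u', v') \<in> oriented_edges m"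
      using ee(2) by (rule extremal_edgesE)
    have "(u, v) \<noteq> (u', v')"
      using ee(3) uv(1) uv'(1) by auto
    then show ?thesis
      using seg_oriented_edges[OF uv(2) uv'(2)] c(2)[OF uv(2)] c(2)[OF uv'(2)] uv(1) uv'(1) by simp
  qed
  \<comment> \<open>This reduces avoiding vertices to avoiding edges: a vertex \<open>w\<close> on
    the curve of \<open>e\<close> also lies on the curve of another edge at \<open>w\<close>, and
    the two curves meet only in common ends. Two neighbours within the block provide an edge
    different from \<open>f\<close>.\<close>
  have covered: "\<exists>e \<in> extremal_edges m. w \<in> e \<and> e \<noteq> f" if w: "w < 14 * m" for w f
  proof -
    define q r where "q = w div 7" and "r = w mod 7"
    have qr: "w = 7 * q + r" "q < 2 * m" "r \<in> {0, 1, 2, 3, 4, 5, 6}"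
      using w by (auto simp: q_def r_def)
    have edge: "{7 * q + i, 7 * q + j} \<in> extremal_edges m" if "(i, j) \<in> set block_edges" for i j
      unfolding extremal_edges_iff using oriented_edges.block[OF qr(2) that] by blast
    have "2 \<le> card (block_nb r)"
      using qr(3) by (elim insertE) (simp_all add: block_nb_simps del: One_nat_def)
    then obtain S where S: "S \<subseteq> block_nb r" "card S = 2"
      by (meson obtain_subset_with_card_n)
    then obtain s t where st: "s \<noteq> t" "s \<in> block_nb r" "t \<in> block_nb r"
      by (auto simp: card_2_iff)
    have "{w, 7 * q + x} \<in> extremal_edges m" if "x \<in> block_nb r" for x
      using that edge[of r x] edge[of x r] qr(1) by (auto simp: block_nb_def insert_commute)
    then have "{w, 7 * q + s} \<in> extremal_edges m" "{w, 7 * q + t} \<in> extremal_edges m"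
      using st by blast+
    moreover have "{w, 7 * q + s} \<noteq> {w, 7 * q + t}"
      using st(1) by (auto simp: doubleton_eq_iff)
    ultimately show ?thesis
      by (cases "{w, 7 * q + s} = f") (auto intro: bexI[of _ "{w, 7 * q + s}"] bexI[of _ "{w, 7 * q + t}"])
  qed
  have "plane_drawing ({..<14 * m}, extremal_edges m) pos c"
    unfolding plane_drawing_def fst_conv snd_conv
  proof (intro conjI ballI impI)
    show "inj_on pos {..<14 * m}"
      using inj_pos by (rule inj_on_subset) simp
    fix e assume e: "e \<in> extremal_edges m"
    then obtain u v where uv: "e = {u, v}" "(u, v) \<in> oriented_edges m"
      by (rule extremal_edgesE)
    have "pos u \<noteq> pos v"
      using oriented_edges_less[OF uv(2)] injD[OF inj_pos, of u v] by auto
    then show "arc (c e)" "{pathstart (c e), pathfinish (c e)} = pos ` e"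
      using c[OF uv(2)] uv(1) by simp_all
    show "path_image (c e) \<inter> pos ` {..<14 * m} = pos ` e"
    proof
      show "pos ` e \<subseteq> path_image (c e) \<inter> pos ` {..<14 * m}"
        using c[OF uv(2)] uv oriented_edges_less[OF uv(2)] by (auto simp: seg_def)
      show "path_image (c e) \<inter> pos ` {..<14 * m} \<subseteq> pos ` e"
      proof clarify
        fix w assume w: "w < 14 * m" "pos w \<in> path_image (c e)"
        obtain e' where e': "e' \<in> extremal_edges m" "w \<in> e'" "e' \<noteq> e"
          using covered[OF w(1)] by blast
        obtain u' v' where uv': "e' = {u', v'}" "(u', v') \<in> oriented_edges m"
          using e'(1) by (rule extremal_edgesE)
        have "pos w \<in> path_image (c e')"
          using e'(2) c[OF uv'(2)] uv'(1) by (auto simp: seg_def)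
        then show "pos w \<in> pos ` e"
          using seg[OF e e'(1)] e'(3) w(2) by blast
      qed
    qed
    fix e' assume "e' \<in> extremal_edges m" "e \<noteq> e'"
    then show "path_image (c e) \<inter> path_image (c e') = pos ` (e \<inter> e')"
      using seg e by blast
  qed
  then show ?thesis
    by (auto simp: planar_def)
qed

text \<open>The far end of the bridge at vertex 0 of block \<open>q\<close>.\<close>

definition partner :: "nat \<Rightarrow> nat" where
  "partner q = 7 * (if even q then q + 1 else q - 1)"

text \<open>Degree 5 occurs only at 1, 2, 3 of a block, because 0 has three neighbours in the block
  and at most one bridge. Both neighbourhoods of an edge at such a vertex then stay in the 7
  vertices of the block, unless the other end is 0.\<close>

lemma free_extremal: "free_of ({..<14 * m}, extremal_edges m) (double_star 2 4)"
proof -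
  interpret simple_graph "{..<14 * m}" "extremal_edges m"
    using finite_simple_extremal by unfold_locales
  define X where "X q r = (\<lambda>s. 7 * q + s) ` block_nb r \<union> (if r = 0 then {partner q} else {})" for q r :: nat
  have fin: "finite (block_nb r)" for r
    using block_nb_less by (rule finite_subset) simp
  have nb: "nb (7 * q + r) \<subseteq> X q r" if r: "r < 7" for q r
  proof
    fix w assume "w \<in> nb (7 * q + r)"
    then have "(7 * q + r, w) \<in> oriented_edges m \<or> (w, 7 * q + r) \<in> oriented_edges m"
      by (simp add: nb_iff extremal_edges_iff)
    then show "w \<in> X q r"
    proof
      assume "(7 * q + r, w) \<in> oriented_edges m"
      then show ?thesis
      proof cases
        case (block q' i j)
        have "i < 7"
          using block_edges_less[OF block(4)] by simp
        then have "q' = q" "i = r"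
          using block(1) r by presburger+
        then show ?thesis
          using block by (simp add: X_def block_nb_def)
      next
        case (bridge k)
        then have "r = 0" "q = 2 * k"
          using r by presburger+
        then show ?thesis
          using bridge by (simp add: X_def partner_def)
      qed
    next
      assume "(w, 7 * q + r) \<in> oriented_edges m"
      then show ?thesis
      proof cases
        case (block q' i j)
        have "j < 7"
          using block_edges_less[OF block(4)] by simp
        then have "q' = q" "j = r"
          using block(2) r by presburger+
        then show ?thesis
          using block by (simp add: X_def block_nb_def)
      next
        case (bridge k)
        then have "r = 0" "q = 2 * k + 1"
          using r by presburger+
        then show ?thesis
          using bridge by (simp add: X_def partner_def)
      qed
    qed
  qed
  have small: "card (nb u \<union> nb v) \<le> 7" if uv: "v \<in> nb u" "5 \<le> deg u" for u v
  proof -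
    define q r where "q = u div 7" and "r = u mod 7"
    have u: "u = 7 * q + r" "r < 7"
      by (simp_all add: q_def r_def)
    have "card (nb u) \<le> card (X q r)"
      unfolding u(1) by (rule card_mono[OF _ nb[OF u(2)]]) (use fin in \<open>simp add: X_def\<close>)
    then have "5 \<le> card (X q r)"
      using uv(2) by (simp add: deg_def)
    moreover have "card (X q r) \<le> card (block_nb r) + (if r = 0 then 1 else 0)"
      unfolding X_def using card_Un_le[of "(\<lambda>s. 7 * q + s) ` block_nb r" "if r = 0 then {partner q} else {}"]
        card_image_le[OF fin[of r], of "\<lambda>s. 7 * q + s"] by (cases "r = 0") simp_all
    ultimately have "5 \<le> card (block_nb r) + (if r = 0 then 1 else 0)"
      by linarith
    moreover have "r \<in> {0, 1, 2, 3, 4, 5, 6}"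
      using u(2) by auto
    ultimately have r: "r \<in> {1, 2, 3}"
      by (auto simp: block_nb_simps)
    then have "v \<in> (\<lambda>s. 7 * q + s) ` block_nb r"
      using nb[OF u(2), of q] uv(1) by (auto simp: u X_def)
    then obtain s where s: "v = 7 * q + s" "s \<in> block_nb r"
      by blast
    have "s < 7"
      using s(2) block_nb_less by blast
    let ?Y = "block_nb r \<union> block_nb s" and ?Z = "if s = 0 then {partner q} else {}"
    have "nb u \<union> nb v \<subseteq> (\<lambda>s. 7 * q + s) ` ?Y \<union> ?Z"
      using nb[OF u(2), of q] nb[OF \<open>s < 7\<close>, of q] r by (auto simp: u(1) s(1) X_def)
    then have "card (nb u \<union> nb v) \<le> card ((\<lambda>s. 7 * q + s) ` ?Y \<union> ?Z)"
      using fin by (intro card_mono) auto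
    also have "\<dots> \<le> card ((\<lambda>s. 7 * q + s) ` ?Y) + card ?Z"
      by (rule card_Un_le)
    also have "\<dots> \<le> card ?Y + card ?Z"
      using fin by (intro add_right_mono card_image_le) auto
    \<comment> \<open>For \<open>s = 0\<close> the neighbourhoods of \<open>r\<close> and 0 cover
      just 6 vertices of the block, which leaves room for the bridge partner.\<close>
    also have "\<dots> \<le> 7"
    proof (cases "s = 0")
      case True
      then show ?thesis
        using r by (elim insertE) (simp_all add: block_nb_simps card_insert_if del: One_nat_def)
    next
      case False
      have "?Y \<subseteq> {..<7}"
        using block_nb_less by simp
      then have "card ?Y \<le> card {..<7::nat}"
        by (intro card_mono) auto
      then show ?thesis
        using False by simp
    qed
    finally show ?thesis .
  qed
  show ?thesis
    unfolding free_of_def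
  proof
    assume "contains_copy ({..<14 * m}, extremal_edges m) (double_star 2 4)"
    then obtain u v where "v \<in> nb u" "5 \<le> deg u" "8 \<le> card (nb u \<union> nb v)"
      by (rule copy_imp_large_union)
    then show False
      using small[of v u] by simp
  qed
qed

subsection \<open>The theorem\<close>

theorem theorem1p1:
  shows "(\<forall>(n::nat) (G :: 'a ugraph).
            n \<ge> 1 \<and> finite_simple_graph G \<and> card (verts G) = n \<and>
            free_of G (double_star 2 4) \<and> planar G
            \<longrightarrow> real (card (edges G)) \<le> 31 / 14 * real n) \<and>
         (\<forall>n::nat. n \<ge> 1 \<and> [n = 0] (mod 14) \<longrightarrow>
            (\<exists>G :: nat ugraph.
               finite_simple_graph G \<and> card (verts G) = n \<and>
               free_of G (double_star 2 4) \<and> planar G \<and>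
               real (card (edges G)) = 31 / 14 * real n))"
proof (intro conjI allI impI)
  fix n :: nat and G :: "'a ugraph"
  assume G: "n \<ge> 1 \<and> finite_simple_graph G \<and> card (verts G) = n \<and> free_of G (double_star 2 4) \<and> planar G"
  obtain V E where VE: "G = (V, E)"
    by (cases G)
  have "14 * card E \<le> 31 * n"
    using planar_S24_free_bound[of V E] G by (auto simp: VE)
  then have "real (14 * card E) \<le> real (31 * n)"
    by (simp only: of_nat_le_iff)
  then show "real (card (edges G)) \<le> 31 / 14 * real n"
    by (simp add: VE)
next
  fix n :: nat
  assume "n \<ge> 1 \<and> [n = 0] (mod 14)"
  then obtain m where m: "n = 14 * m"
    by (auto simp: cong_0_iff)
  show "\<exists>G :: nat ugraph. finite_simple_graph G \<and> card (verts G) = n \<and>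
      free_of G (double_star 2 4) \<and> planar G \<and> real (card (edges G)) = 31 / 14 * real n"
    by (rule exI[of _ "({..<14 * m}, extremal_edges m)"])
       (simp add: m finite_simple_extremal free_extremal planar_extremal card_extremal_edges)
qed

end
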